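(* Let $R$ be a ring with unity, let $\mathcal{X}$ be a semibrick of left $R$-modules and let $Y$ be a left $R$-module. For any $f\in\mathrm{Hom}(X,Y_{\mathcal{X}}(\infty))$ with $X\in\mathcal{X}$, the image of $f$ is contained in $Y$.
   Context: A brick is a finitely presented left $R$-module whose endomorphism ring is a division ring. A semibrick is a class $\mathcal{X}$ of pairwise non-isomorphic bricks with $\mathrm{Hom}(X,X')=0$ for distinct $X,X'\in\mathcal{X}$. $\mathcal{X}$-universal sequences: let $Y$ be a module. For each $X\in\mathcal{X}$, $\mathrm{Ext}^1(X,Y)$ is a left $\mathrm{End}(X)$-module (endomorphisms act by pull-back; compositions written from left to right). Choose a basis $(0\to Y\to M_{X,i}\to X\to 0)_{i\in I_X}$ over the division ring $\mathrm{End}(X)$. The $\mathcal{X}$-universal short exact sequence $0\to Y\to M\to\bigoplus_{X\in\mathcal{X}}X^{(I_X)}\to 0$ starting from $Y$ is the push-out of $0\to\bigoplus_{X}Y^{(I_X)}\to\bigoplus_{X,i}M_{X,i}\to\bigoplus_{X}X^{(I_X)}\to 0$ along the summation map $\bigoplus_X Y^{(I_X)}\to Y$. Define $Y_{\mathcal{X}}(1)=Y$ and, recursively, let $Y_{\mathcal{X}}(i)\to Y_{\mathcal{X}}(i+1)$ be the monomorphism of an $\mathcal{X}$-universal short exact sequence starting from $Y_{\mathcal{X}}(i)$. $Y_{\mathcal{X}}(\infty)$ is the direct limit of this system (well defined up to isomorphism), and $Y$ is viewed as a submodule of $Y_{\mathcal{X}}(\infty)$ via the canonical embedding. *)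

theory Defs
  imports "HOL-Algebra.Module" "HOL-Algebra.AbelCoset" "HOL.Hull"
begin

section \<open>Left modules over a ring with unity\<close>

text \<open>The locale \<^locale>\<open>module\<close> of \<^theory>\<open>HOL-Algebra.Module\<close> requires a commutative ring of scalars;
  here the ring is arbitrary, with the same record type and the same axioms. The ring
  multiplication and unit stored in that record have no meaning for a module.\<close>

locale left_module = R?: ring R + M?: abelian_group M
  for R :: "('r, 'q) ring_scheme" (structure) and M :: "('r, 'a, 'p) module_scheme" (structure) +
  assumes smult_closed [simp, intro]:
      "\<lbrakk>a \<in> carrier R; x \<in> carrier M\<rbrakk> \<Longrightarrow> a \<odot>\<^bsub>M\<^esub> x \<in> carrier M"
    and smult_l_distr:
      "\<lbrakk>a \<in> carrier R; b \<in> carrier R; x \<in> carrier M\<rbrakk> \<Longrightarrow>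
        (a \<oplus>\<^bsub>R\<^esub> b) \<odot>\<^bsub>M\<^esub> x = a \<odot>\<^bsub>M\<^esub> x \<oplus>\<^bsub>M\<^esub> b \<odot>\<^bsub>M\<^esub> x"
    and smult_r_distr:
      "\<lbrakk>a \<in> carrier R; x \<in> carrier M; y \<in> carrier M\<rbrakk> \<Longrightarrow>
        a \<odot>\<^bsub>M\<^esub> (x \<oplus>\<^bsub>M\<^esub> y) = a \<odot>\<^bsub>M\<^esub> x \<oplus>\<^bsub>M\<^esub> a \<odot>\<^bsub>M\<^esub> y"
    and smult_assoc1:
      "\<lbrakk>a \<in> carrier R; b \<in> carrier R; x \<in> carrier M\<rbrakk> \<Longrightarrow>
        (a \<otimes>\<^bsub>R\<^esub> b) \<odot>\<^bsub>M\<^esub> x = a \<odot>\<^bsub>M\<^esub> (b \<odot>\<^bsub>M\<^esub> x)"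
    and smult_one [simp]:
      "x \<in> carrier M \<Longrightarrow> \<one>\<^bsub>R\<^esub> \<odot>\<^bsub>M\<^esub> x = x"

text \<open>As for \<^const>\<open>hom\<close>, only the values on the carrier matter.\<close>

definition mod_hom ::
  "('r, 'q) ring_scheme \<Rightarrow> ('r, 'a) module \<Rightarrow> ('r, 'b) module \<Rightarrow> ('a \<Rightarrow> 'b) set" where
  "mod_hom R M N = {h \<in> carrier M \<rightarrow> carrier N.
     (\<forall>x\<in>carrier M. \<forall>y\<in>carrier M. h (x \<oplus>\<^bsub>M\<^esub> y) = h x \<oplus>\<^bsub>N\<^esub> h y) \<and>
     (\<forall>r\<in>carrier R. \<forall>x\<in>carrier M. h (r \<odot>\<^bsub>M\<^esub> x) = r \<odot>\<^bsub>N\<^esub> h x)}"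

definition mod_isomorphic ::
  "('r, 'q) ring_scheme \<Rightarrow> ('r, 'a) module \<Rightarrow> ('r, 'b) module \<Rightarrow> bool" where
  "mod_isomorphic R M N \<longleftrightarrow> (\<exists>h \<in> mod_hom R M N. bij_betw h (carrier M) (carrier N))"

definition self_module :: "('r, 'q) ring_scheme \<Rightarrow> ('r, 'r) module" where
  "self_module R = \<lparr>carrier = carrier R, monoid.mult = undefined, monoid.one = undefined,
     ring.zero = \<zero>\<^bsub>R\<^esub>, ring.add = ring.add R, smult = monoid.mult R\<rparr>"

definition mod_prod :: "('r, 'a) module \<Rightarrow> ('r, 'b) module \<Rightarrow> ('r, 'a \<times> 'b) module" where
  "mod_prod M N = \<lparr>carrier = carrier M \<times> carrier N, monoid.mult = undefined, monoid.one = undefined,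
     ring.zero = (\<zero>\<^bsub>M\<^esub>, \<zero>\<^bsub>N\<^esub>),
     ring.add = (\<lambda>(x, y) (x', y'). (x \<oplus>\<^bsub>M\<^esub> x', y \<oplus>\<^bsub>N\<^esub> y')),
     smult = (\<lambda>r (x, y). (r \<odot>\<^bsub>M\<^esub> x, r \<odot>\<^bsub>N\<^esub> y))\<rparr>"

definition direct_sum :: "'i set \<Rightarrow> ('i \<Rightarrow> ('r, 'a) module) \<Rightarrow> ('r, 'i \<Rightarrow> 'a) module" where
  "direct_sum I M = \<lparr>carrier = {v \<in> \<Pi>\<^sub>E i\<in>I. carrier (M i). finite {i \<in> I. v i \<noteq> \<zero>\<^bsub>M i\<^esub>}},
     monoid.mult = undefined, monoid.one = undefined,
     ring.zero = (\<lambda>i\<in>I. \<zero>\<^bsub>M i\<^esub>),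
     ring.add = (\<lambda>v w. \<lambda>i\<in>I. v i \<oplus>\<^bsub>M i\<^esub> w i),
     smult = (\<lambda>r v. \<lambda>i\<in>I. r \<odot>\<^bsub>M i\<^esub> v i)\<rparr>"

definition summation_map :: "'i set \<Rightarrow> ('r, 'a) module \<Rightarrow> ('i \<Rightarrow> 'a) \<Rightarrow> 'a" where
  "summation_map I M v = finsum M v {i \<in> I. v i \<noteq> \<zero>\<^bsub>M\<^esub>}"

definition mod_quot :: "('r, 'a) module \<Rightarrow> 'a set \<Rightarrow> ('r, 'a set) module" where
  "mod_quot M N = \<lparr>carrier = a_rcosets\<^bsub>M\<^esub> N, monoid.mult = undefined, monoid.one = undefined,
     ring.zero = N,
     ring.add = set_add M,
     smult = (\<lambda>r C. \<Union>x\<in>C. N +>\<^bsub>M\<^esub> (r \<odot>\<^bsub>M\<^esub> x))\<rparr>"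

text \<open>There is an exact sequence \<open>R\<^sup>m \<rightarrow> R\<^sup>n \<rightarrow> X \<rightarrow> 0\<close>.\<close>

definition finitely_presented :: "('r, 'q) ring_scheme \<Rightarrow> ('r, 'x) module \<Rightarrow> bool" where
  "finitely_presented R X \<longleftrightarrow> (\<exists>(m::nat) (n::nat) q p.
     q \<in> mod_hom R (direct_sum {..<m} (\<lambda>_. self_module R)) (direct_sum {..<n} (\<lambda>_. self_module R)) \<and>
     p \<in> mod_hom R (direct_sum {..<n} (\<lambda>_. self_module R)) X \<and>
     q ` carrier (direct_sum {..<m} (\<lambda>_. self_module R)) =
       a_kernel (direct_sum {..<n} (\<lambda>_. self_module R)) X p \<and>
     p ` carrier (direct_sum {..<n} (\<lambda>_. self_module R)) = carrier X)"


section \<open>Bricks and semibricks\<close>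

text \<open>Compositions are written from left to right: \<open>\<phi> \<otimes> \<psi>\<close> is first \<open>\<phi>\<close>, then \<open>\<psi>\<close>.
  Extensionality makes equality of endomorphisms the equality of functions on the carrier.\<close>

definition End_ring :: "('r, 'q) ring_scheme \<Rightarrow> ('r, 'x) module \<Rightarrow> ('x \<Rightarrow> 'x) ring" where
  "End_ring R X = \<lparr>carrier = mod_hom R X X \<inter> extensional (carrier X),
     monoid.mult = (\<lambda>\<phi> \<psi>. \<lambda>x\<in>carrier X. \<psi> (\<phi> x)),
     monoid.one = (\<lambda>x\<in>carrier X. x),
     ring.zero = (\<lambda>x\<in>carrier X. \<zero>\<^bsub>X\<^esub>),
     ring.add = (\<lambda>\<phi> \<psi>. \<lambda>x\<in>carrier X. \<phi> x \<oplus>\<^bsub>X\<^esub> \<psi> x)\<rparr>"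

text \<open>A division ring, as in the locale \<^locale>\<open>field\<close> but without commutativity (the equation
  also excludes the zero ring).\<close>

locale skew_field = ring +
  assumes skew_field_Units: "Units R = carrier R - {\<zero>}"

definition brick :: "('r, 'q) ring_scheme \<Rightarrow> ('r, 'x) module \<Rightarrow> bool" where
  "brick R X \<longleftrightarrow> left_module R X \<and> finitely_presented R X \<and> skew_field (End_ring R X)"

text \<open>Finitely presented modules are quotients of some \<open>R\<^sup>n\<close>, so a class of pairwise
  non-isomorphic ones is a set and all its members can be given carriers in one type.\<close>

definition semibrick :: "('r, 'q) ring_scheme \<Rightarrow> ('r, 'x) module set \<Rightarrow> bool" where
  "semibrick R \<X> \<longleftrightarrow> (\<forall>X\<in>\<X>. brick R X) \<and>
     (\<forall>X\<in>\<X>. \<forall>X'\<in>\<X>. X \<noteq> X' \<longrightarrow>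
        \<not> mod_isomorphic R X X' \<and>
        (\<forall>h \<in> mod_hom R X X'. \<forall>x\<in>carrier X. h x = \<zero>\<^bsub>X'\<^esub>))"


section \<open>Short exact sequences and Ext\<close>

record ('r, 'y, 'e, 'x) ses =
  mid :: "('r, 'e) module"
  inc :: "'y \<Rightarrow> 'e"
  prj :: "'e \<Rightarrow> 'x"

definition short_exact ::
  "('r, 'q) ring_scheme \<Rightarrow> ('r, 'y) module \<Rightarrow> ('r, 'x) module \<Rightarrow> ('r, 'y, 'e, 'x) ses \<Rightarrow> bool" where
  "short_exact R Y X S \<longleftrightarrow> left_module R (mid S) \<and>
     inc S \<in> mod_hom R Y (mid S) \<and> prj S \<in> mod_hom R (mid S) X \<and>
     inj_on (inc S) (carrier Y) \<and>
     inc S ` carrier Y = a_kernel (mid S) X (prj S) \<and>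
     prj S ` carrier (mid S) = carrier X"

definition ses_equiv ::
  "('r, 'q) ring_scheme \<Rightarrow> ('r, 'y) module \<Rightarrow> ('r, 'y, 'e, 'x) ses \<Rightarrow> ('r, 'y, 'f, 'x) ses \<Rightarrow> bool" where
  "ses_equiv R Y S T \<longleftrightarrow> (\<exists>h \<in> mod_hom R (mid S) (mid T).
     bij_betw h (carrier (mid S)) (carrier (mid T)) \<and>
     (\<forall>y\<in>carrier Y. h (inc S y) = inc T y) \<and>
     (\<forall>e\<in>carrier (mid S). prj T (h e) = prj S e))"

text \<open>Pull-back of \<open>0 \<rightarrow> Y \<rightarrow> E \<rightarrow> X \<rightarrow> 0\<close> along \<open>k : X' \<rightarrow> X\<close>.\<close>

definition ses_pullback ::
  "('r, 'x') module \<Rightarrow> ('x' \<Rightarrow> 'x) \<Rightarrow> ('r, 'y, 'e, 'x) ses \<Rightarrow> ('r, 'y, 'e \<times> 'x', 'x') ses" where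
  "ses_pullback X' k S =
     \<lparr>mid = (mod_prod (mid S) X')
        \<lparr>carrier := {(e, x'). e \<in> carrier (mid S) \<and> x' \<in> carrier X' \<and> prj S e = k x'}\<rparr>,
      inc = (\<lambda>y. (inc S y, \<zero>\<^bsub>X'\<^esub>)),
      prj = snd\<rparr>"

text \<open>Push-out of \<open>0 \<rightarrow> Y \<rightarrow> E \<rightarrow> X \<rightarrow> 0\<close> along \<open>h : Y \<rightarrow> Y'\<close>: the middle term is
  \<open>Y' \<oplus> E\<close> modulo all \<open>(h y, - y)\<close>. The map to \<open>X\<close> is constant on cosets.\<close>

definition pushout_relations ::
  "('r, 'y) module \<Rightarrow> ('y \<Rightarrow> 'y') \<Rightarrow> ('r, 'y, 'e, 'x) ses \<Rightarrow> ('y' \<times> 'e) set" where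
  "pushout_relations Y h S = (\<lambda>y. (h y, \<ominus>\<^bsub>mid S\<^esub> inc S y)) ` carrier Y"

definition ses_pushout ::
  "('r, 'y) module \<Rightarrow> ('r, 'y') module \<Rightarrow> ('y \<Rightarrow> 'y') \<Rightarrow> ('r, 'y, 'e, 'x) ses
    \<Rightarrow> ('r, 'y', ('y' \<times> 'e) set, 'x) ses" where
  "ses_pushout Y Y' h S =
     \<lparr>mid = mod_quot (mod_prod Y' (mid S)) (pushout_relations Y h S),
      inc = (\<lambda>y'. pushout_relations Y h S +>\<^bsub>mod_prod Y' (mid S)\<^esub> (y', \<zero>\<^bsub>mid S\<^esub>)),
      prj = (\<lambda>C. the_elem ((\<lambda>(y', e). prj S e) ` C))\<rparr>"

definition ses_prod ::
  "('r, 'y, 'e, 'x) ses \<Rightarrow> ('r, 'y', 'e', 'x') ses \<Rightarrow> ('r, 'y \<times> 'y', 'e \<times> 'e', 'x \<times> 'x') ses" where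
  "ses_prod S T = \<lparr>mid = mod_prod (mid S) (mid T),
     inc = map_prod (inc S) (inc T), prj = map_prod (prj S) (prj T)\<rparr>"

definition ses_direct_sum ::
  "'i set \<Rightarrow> ('i \<Rightarrow> ('r, 'y, 'e, 'x) ses) \<Rightarrow> ('r, 'i \<Rightarrow> 'y, 'i \<Rightarrow> 'e, 'i \<Rightarrow> 'x) ses" where
  "ses_direct_sum I S = \<lparr>mid = direct_sum I (\<lambda>i. mid (S i)),
     inc = (\<lambda>v. \<lambda>i\<in>I. inc (S i) (v i)), prj = (\<lambda>v. \<lambda>i\<in>I. prj (S i) (v i))\<rparr>"

text \<open>The Baer sum: pull back \<open>S \<oplus> T\<close> along the diagonal of \<open>X\<close> and push out along the
  addition of \<open>Y\<close>.\<close>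

definition baer_sum ::
  "('r, 'y) module \<Rightarrow> ('r, 'x) module \<Rightarrow> ('r, 'y, 'e, 'x) ses \<Rightarrow> ('r, 'y, 'f, 'x) ses
    \<Rightarrow> ('r, 'y, ('y \<times> (('e \<times> 'f) \<times> 'x)) set, 'x) ses" where
  "baer_sum Y X S T =
     ses_pushout (mod_prod Y Y) Y (\<lambda>(y, y'). y \<oplus>\<^bsub>Y\<^esub> y')
       (ses_pullback X (\<lambda>x. (x, x)) (ses_prod S T))"

definition split_ses ::
  "('r, 'y) module \<Rightarrow> ('r, 'x) module \<Rightarrow> ('r, 'y, 'x \<times> 'y, 'x) ses" where
  "split_ses Y X = \<lparr>mid = mod_prod X Y, inc = (\<lambda>y. (\<zero>\<^bsub>X\<^esub>, y)), prj = fst\<rparr>"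

text \<open>The middle term of an extension of \<open>X\<close> by \<open>Y\<close> is in bijection with \<open>X \<times> Y\<close>. Hence every
  extension, whatever the type of its middle term, is equivalent to one with middle term in
  the type \<open>'x \<times> 'y\<close>, and its class may be represented by the latter extensions only.\<close>

definition ext_class ::
  "('r, 'q) ring_scheme \<Rightarrow> ('r, 'y) module \<Rightarrow> ('r, 'x) module \<Rightarrow> ('r, 'y, 'e, 'x) ses
    \<Rightarrow> ('r, 'y, 'x \<times> 'y, 'x) ses set" where
  "ext_class R Y X S = {T. short_exact R Y X T \<and> ses_equiv R Y T S}"

text \<open>\<open>Ext\<^sup>1(X, Y)\<close> as a left module over \<open>End(X)\<close>. The unions are over representatives of
  classes; all members contribute the same class.\<close>

definition Ext1 ::
  "('r, 'q) ring_scheme \<Rightarrow> ('r, 'x) module \<Rightarrow> ('r, 'y) module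
    \<Rightarrow> ('x \<Rightarrow> 'x, ('r, 'y, 'x \<times> 'y, 'x) ses set) module" where
  "Ext1 R X Y = \<lparr>carrier = ext_class R Y X ` {S :: ('r, 'y, 'x \<times> 'y, 'x) ses. short_exact R Y X S},
     monoid.mult = undefined, monoid.one = undefined,
     ring.zero = ext_class R Y X (split_ses Y X),
     ring.add = (\<lambda>C D. \<Union>S\<in>C. \<Union>T\<in>D. ext_class R Y X (baer_sum Y X S T)),
     smult = (\<lambda>\<phi> C. \<Union>S\<in>C. ext_class R Y X (ses_pullback X \<phi> S))\<rparr>"


section \<open>Universal short exact sequences and the direct limit\<close>

definition lin_comb ::
  "('k, 'q) ring_scheme \<Rightarrow> ('k, 'v) module \<Rightarrow> 'i set \<Rightarrow> ('i \<Rightarrow> 'v) \<Rightarrow> ('i \<Rightarrow> 'k) \<Rightarrow> 'v" where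
  "lin_comb K V I b a = (\<Oplus>\<^bsub>V\<^esub>i\<in>{i \<in> I. a i \<noteq> \<zero>\<^bsub>K\<^esub>}. a i \<odot>\<^bsub>V\<^esub> b i)"

text \<open>The coefficient families are the finitely supported ones.\<close>

definition is_basis ::
  "('k, 'q) ring_scheme \<Rightarrow> ('k, 'v) module \<Rightarrow> 'i set \<Rightarrow> ('i \<Rightarrow> 'v) \<Rightarrow> bool" where
  "is_basis K V I b \<longleftrightarrow> b \<in> I \<rightarrow> carrier V \<and>
     (\<forall>a \<in> carrier (direct_sum I (\<lambda>_. self_module K)).
        lin_comb K V I b a = \<zero>\<^bsub>V\<^esub> \<longrightarrow> (\<forall>i\<in>I. a i = \<zero>\<^bsub>K\<^esub>)) \<and>
     (\<forall>v \<in> carrier V. \<exists>a \<in> carrier (direct_sum I (\<lambda>_. self_module K)). v = lin_comb K V I b a)"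

text \<open>\<open>B X\<close> is a set of short exact sequences \<open>0 \<rightarrow> Y \<rightarrow> M \<rightarrow> X \<rightarrow> 0\<close>, indexed by themselves, whose
  classes form a basis of \<open>Ext\<^sup>1(X, Y)\<close> over \<open>End(X)\<close>.\<close>

definition ext_basis ::
  "('r, 'q) ring_scheme \<Rightarrow> ('r, 'x) module \<Rightarrow> ('r, 'y) module \<Rightarrow> ('r, 'y, 'x \<times> 'y, 'x) ses set \<Rightarrow> bool" where
  "ext_basis R X Y B \<longleftrightarrow> (\<forall>S\<in>B. short_exact R Y X S) \<and>
     is_basis (End_ring R X) (Ext1 R X Y) B (ext_class R Y X)"

text \<open>The push-out along the summation map of the direct sum of the chosen sequences; the index
  set consists of the pairs \<open>(X, i)\<close> with \<open>X \<in> \<X>\<close> and \<open>i \<in> B X\<close>.\<close>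

definition universal_pushout ::
  "('r, 'x) module set \<Rightarrow> ('r, 'y) module \<Rightarrow> (('r, 'x) module \<Rightarrow> ('r, 'y, 'x \<times> 'y, 'x) ses set)
    \<Rightarrow> ('r, 'y,
        ('y \<times> (('r, 'x) module \<times> ('r, 'y, 'x \<times> 'y, 'x) ses \<Rightarrow> 'x \<times> 'y)) set,
        ('r, 'x) module \<times> ('r, 'y, 'x \<times> 'y, 'x) ses \<Rightarrow> 'x) ses" where
  "universal_pushout \<X> Y B =
     ses_pushout (direct_sum (Sigma \<X> B) (\<lambda>_. Y)) Y (summation_map (Sigma \<X> B) Y)
       (ses_direct_sum (Sigma \<X> B) snd)"

text \<open>\<open>j : Y \<rightarrow> M\<close> is the monomorphism of an \<open>\<X>\<close>-universal short exact sequence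
  \<open>0 \<rightarrow> Y \<rightarrow> M \<rightarrow> \<Oplus> X\<close> starting from \<open>Y\<close>. As a push-out is only determined up to
  isomorphism, the sequence need only be equivalent to the push-out constructed above.\<close>

definition universal_mono ::
  "('r, 'q) ring_scheme \<Rightarrow> ('r, 'x) module set \<Rightarrow> ('r, 'y) module \<Rightarrow> ('r, 'm) module \<Rightarrow> ('y \<Rightarrow> 'm) \<Rightarrow> bool" where
  "universal_mono R \<X> Y M j \<longleftrightarrow> (\<exists>B g. (\<forall>X\<in>\<X>. ext_basis R X Y (B X)) \<and>
     short_exact R Y (direct_sum (Sigma \<X> B) fst) \<lparr>mid = M, inc = j, prj = g\<rparr> \<and>
     ses_equiv R Y \<lparr>mid = M, inc = j, prj = g\<rparr> (universal_pushout \<X> Y B))"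

text \<open>Indices start at \<open>0\<close>: the module \<open>T n\<close> is \<open>Y\<^bsub>\<X>\<^esub>(n + 1)\<close>. All terms have carriers in one
  type \<open>'m\<close>; this is no restriction, since \<open>'m\<close> is arbitrary and the terms of any such
  sequence (including \<open>Y\<close>) can be copied into one sufficiently large type.\<close>

definition universal_tower ::
  "('r, 'q) ring_scheme \<Rightarrow> ('r, 'x) module set \<Rightarrow> ('r, 'm) module
    \<Rightarrow> (nat \<Rightarrow> ('r, 'm) module) \<Rightarrow> (nat \<Rightarrow> 'm \<Rightarrow> 'm) \<Rightarrow> bool" where
  "universal_tower R \<X> Y T j \<longleftrightarrow> T 0 = Y \<and> (\<forall>n. universal_mono R \<X> (T n) (T (Suc n)) (j n))"

definition ds_inj :: "'i set \<Rightarrow> ('i \<Rightarrow> ('r, 'a) module) \<Rightarrow> 'i \<Rightarrow> 'a \<Rightarrow> 'i \<Rightarrow> 'a" where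
  "ds_inj I M i x = (\<lambda>k\<in>I. if k = i then x else \<zero>\<^bsub>M k\<^esub>)"

text \<open>The direct limit of \<open>T 0 \<rightarrow> T 1 \<rightarrow> T 2 \<rightarrow> \<dots>\<close>: the direct sum of the \<open>T n\<close> modulo the submodule
  generated by the differences of \<open>y \<in> T n\<close> and its image in \<open>T (n + 1)\<close>.\<close>

definition dirlim_relations ::
  "('r, 'q) ring_scheme \<Rightarrow> (nat \<Rightarrow> ('r, 'm) module) \<Rightarrow> (nat \<Rightarrow> 'm \<Rightarrow> 'm) \<Rightarrow> (nat \<Rightarrow> 'm) set" where
  "dirlim_relations R T j = (\<lambda>N. submodule N R (direct_sum UNIV T)) hull
     (\<Union>n. (\<lambda>y. ds_inj UNIV T n y \<ominus>\<^bsub>direct_sum UNIV T\<^esub> ds_inj UNIV T (Suc n) (j n y)) ` carrier (T n))"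

definition dirlim ::
  "('r, 'q) ring_scheme \<Rightarrow> (nat \<Rightarrow> ('r, 'm) module) \<Rightarrow> (nat \<Rightarrow> 'm \<Rightarrow> 'm) \<Rightarrow> ('r, (nat \<Rightarrow> 'm) set) module" where
  "dirlim R T j = mod_quot (direct_sum UNIV T) (dirlim_relations R T j)"

definition dirlim_map ::
  "('r, 'q) ring_scheme \<Rightarrow> (nat \<Rightarrow> ('r, 'm) module) \<Rightarrow> (nat \<Rightarrow> 'm \<Rightarrow> 'm) \<Rightarrow> nat \<Rightarrow> 'm \<Rightarrow> (nat \<Rightarrow> 'm) set" where
  "dirlim_map R T j n y = dirlim_relations R T j +>\<^bsub>direct_sum UNIV T\<^esub> ds_inj UNIV T n y"

end

theory Submission
  imports Defs
begin

text \<open>A section \<open>s\<close> of an extension \<open>0 \<rightarrow> Y \<rightarrow> E \<rightarrow> X \<rightarrow> 0\<close> determines \<open>c(r, x, x') \<in> Y\<close> with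
  \<open>r s(x) + s(x') = s(r x + x') + c(r, x, x')\<close>. Baer sum, pull-back and push-out of extensions become
  pointwise operations on \<open>c\<close>, which makes linear combinations in \<open>Ext\<^sup>1(X, Y)\<close> computable.
  If \<open>0 \<rightarrow> Y \<rightarrow> M \<rightarrow> \<Oplus> X \<rightarrow> 0\<close> is universal, a homomorphism \<open>X \<rightarrow> M\<close> composed with \<open>M \<rightarrow> \<Oplus> X\<close> has as
  components endomorphisms of the brick \<open>X\<close>, which are the coefficients of a linear relation between
  basis elements; hence they vanish and \<open>X \<rightarrow> M\<close> has image in \<open>Y\<close>. As \<open>X\<close> is finitely generated and
  the maps of the tower are injective, a homomorphism from \<open>X\<close> to the limit factors through some \<open>T n\<close>,
  and one descends to \<open>T 0 = Y\<close>.\<close>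

section \<open>Homomorphisms, submodules and quotients\<close>

lemma left_moduleI:
  assumes "ring R" "abelian_group M"
    and "\<And>a x. \<lbrakk>a \<in> carrier R; x \<in> carrier M\<rbrakk> \<Longrightarrow> a \<odot>\<^bsub>M\<^esub> x \<in> carrier M"
    and "\<And>a b x. \<lbrakk>a \<in> carrier R; b \<in> carrier R; x \<in> carrier M\<rbrakk> \<Longrightarrow>
          (a \<oplus>\<^bsub>R\<^esub> b) \<odot>\<^bsub>M\<^esub> x = a \<odot>\<^bsub>M\<^esub> x \<oplus>\<^bsub>M\<^esub> b \<odot>\<^bsub>M\<^esub> x"
    and "\<And>a x y. \<lbrakk>a \<in> carrier R; x \<in> carrier M; y \<in> carrier M\<rbrakk> \<Longrightarrow>
          a \<odot>\<^bsub>M\<^esub> (x \<oplus>\<^bsub>M\<^esub> y) = a \<odot>\<^bsub>M\<^esub> x \<oplus>\<^bsub>M\<^esub> a \<odot>\<^bsub>M\<^esub> y"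
    and "\<And>a b x. \<lbrakk>a \<in> carrier R; b \<in> carrier R; x \<in> carrier M\<rbrakk> \<Longrightarrow>
          (a \<otimes>\<^bsub>R\<^esub> b) \<odot>\<^bsub>M\<^esub> x = a \<odot>\<^bsub>M\<^esub> (b \<odot>\<^bsub>M\<^esub> x)"
    and "\<And>x. x \<in> carrier M \<Longrightarrow> \<one>\<^bsub>R\<^esub> \<odot>\<^bsub>M\<^esub> x = x"
  shows "left_module R M"
  using assms by (simp add: left_module_def left_module_axioms_def)

context left_module
begin

lemma diff_eq_zero_iff:
  assumes "x \<in> carrier M" "y \<in> carrier M"
  shows "x \<ominus>\<^bsub>M\<^esub> y = \<zero>\<^bsub>M\<^esub> \<longleftrightarrow> x = y"
  using assms M.minus_equality[of x "\<ominus>\<^bsub>M\<^esub> y"] by (auto simp: M.minus_eq M.r_neg)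

lemma minus_zero [simp]: "\<ominus>\<^bsub>M\<^esub> \<zero>\<^bsub>M\<^esub> = \<zero>\<^bsub>M\<^esub>"
  using M.minus_equality[OF M.l_zero] by blast

lemma smult_zero_right [simp]:
  assumes "r \<in> carrier R" shows "r \<odot>\<^bsub>M\<^esub> \<zero>\<^bsub>M\<^esub> = \<zero>\<^bsub>M\<^esub>"
proof -
  have "r \<odot>\<^bsub>M\<^esub> \<zero>\<^bsub>M\<^esub> \<oplus>\<^bsub>M\<^esub> r \<odot>\<^bsub>M\<^esub> \<zero>\<^bsub>M\<^esub> = r \<odot>\<^bsub>M\<^esub> \<zero>\<^bsub>M\<^esub> \<oplus>\<^bsub>M\<^esub> \<zero>\<^bsub>M\<^esub>"
    using smult_r_distr[of r "\<zero>\<^bsub>M\<^esub>" "\<zero>\<^bsub>M\<^esub>"] assms by simp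
  then show ?thesis using assms by simp
qed

lemma smult_zero_left [simp]:
  assumes "x \<in> carrier M" shows "\<zero>\<^bsub>R\<^esub> \<odot>\<^bsub>M\<^esub> x = \<zero>\<^bsub>M\<^esub>"
proof -
  have "\<zero>\<^bsub>R\<^esub> \<odot>\<^bsub>M\<^esub> x \<oplus>\<^bsub>M\<^esub> \<zero>\<^bsub>R\<^esub> \<odot>\<^bsub>M\<^esub> x = \<zero>\<^bsub>R\<^esub> \<odot>\<^bsub>M\<^esub> x \<oplus>\<^bsub>M\<^esub> \<zero>\<^bsub>M\<^esub>"
    using smult_l_distr[of "\<zero>\<^bsub>R\<^esub>" "\<zero>\<^bsub>R\<^esub>" x] assms by simp
  then show ?thesis using assms by simp
qed

lemma smult_minus:
  assumes "r \<in> carrier R" "x \<in> carrier M"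
  shows "r \<odot>\<^bsub>M\<^esub> (\<ominus>\<^bsub>M\<^esub> x) = \<ominus>\<^bsub>M\<^esub> (r \<odot>\<^bsub>M\<^esub> x)"
proof -
  have "r \<odot>\<^bsub>M\<^esub> (\<ominus>\<^bsub>M\<^esub> x) \<oplus>\<^bsub>M\<^esub> r \<odot>\<^bsub>M\<^esub> x = \<zero>\<^bsub>M\<^esub>"
    using smult_r_distr[of r "\<ominus>\<^bsub>M\<^esub> x" x] assms by (simp add: M.l_neg)
  then show ?thesis using assms by (simp add: M.minus_equality)
qed

lemma submoduleI:
  assumes "H \<subseteq> carrier M" "\<zero>\<^bsub>M\<^esub> \<in> H"
    and "\<And>a b. \<lbrakk>a \<in> H; b \<in> H\<rbrakk> \<Longrightarrow> a \<oplus>\<^bsub>M\<^esub> b \<in> H"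
    and smult: "\<And>a x. \<lbrakk>a \<in> carrier R; x \<in> H\<rbrakk> \<Longrightarrow> a \<odot>\<^bsub>M\<^esub> x \<in> H"
  shows "submodule H R M"
proof -
  have "\<ominus>\<^bsub>M\<^esub> x = (\<ominus>\<^bsub>R\<^esub> \<one>\<^bsub>R\<^esub>) \<odot>\<^bsub>M\<^esub> x" if "x \<in> carrier M" for x
  proof -
    have "(\<ominus>\<^bsub>R\<^esub> \<one>\<^bsub>R\<^esub>) \<odot>\<^bsub>M\<^esub> x \<oplus>\<^bsub>M\<^esub> \<one>\<^bsub>R\<^esub> \<odot>\<^bsub>M\<^esub> x = \<zero>\<^bsub>M\<^esub>"
      using smult_l_distr[of "\<ominus>\<^bsub>R\<^esub> \<one>\<^bsub>R\<^esub>" "\<one>\<^bsub>R\<^esub>" x] that by (simp add: R.l_neg)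
    then show ?thesis using that by (simp add: M.minus_equality)
  qed
  then have "\<ominus>\<^bsub>M\<^esub> x \<in> H" if "x \<in> H" for x
    using that assms(1) smult[of "\<ominus>\<^bsub>R\<^esub> \<one>\<^bsub>R\<^esub>" x] by (metis R.a_inv_closed R.one_closed subsetD)
  then show ?thesis
    using assms unfolding submodule_def submodule_axioms_def
    by (auto simp: a_inv_def intro!: subgroup.intro)
qed

end

lemma mod_homI:
  assumes "left_module R M"
    and "\<And>x. x \<in> carrier M \<Longrightarrow> h x \<in> carrier N"
    and lin: "\<And>r x y. \<lbrakk>r \<in> carrier R; x \<in> carrier M; y \<in> carrier M\<rbrakk> \<Longrightarrow>
      h (r \<odot>\<^bsub>M\<^esub> x \<oplus>\<^bsub>M\<^esub> y) = r \<odot>\<^bsub>N\<^esub> h x \<oplus>\<^bsub>N\<^esub> h y"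
    and "left_module R N"
  shows "h \<in> mod_hom R M N"
proof -
  interpret M: left_module R M by fact
  interpret N: left_module R N by fact
  have add: "h (x \<oplus>\<^bsub>M\<^esub> y) = h x \<oplus>\<^bsub>N\<^esub> h y" if "x \<in> carrier M" "y \<in> carrier M" for x y
    using lin[of "\<one>\<^bsub>R\<^esub>" x y] that assms(2) by simp
  have "h \<zero>\<^bsub>M\<^esub> \<oplus>\<^bsub>N\<^esub> h \<zero>\<^bsub>M\<^esub> = h \<zero>\<^bsub>M\<^esub> \<oplus>\<^bsub>N\<^esub> \<zero>\<^bsub>N\<^esub>"
    using add[of "\<zero>\<^bsub>M\<^esub>" "\<zero>\<^bsub>M\<^esub>"] assms(2) by simp
  then have "h \<zero>\<^bsub>M\<^esub> = \<zero>\<^bsub>N\<^esub>"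
    using assms(2) by simp
  then have "h (r \<odot>\<^bsub>M\<^esub> x) = r \<odot>\<^bsub>N\<^esub> h x" if "r \<in> carrier R" "x \<in> carrier M" for r x
    using lin[of r x "\<zero>\<^bsub>M\<^esub>"] that assms(2) by simp
  then show ?thesis using add assms(2) by (auto simp: mod_hom_def)
qed

lemma mod_hom_closed: "h \<in> mod_hom R M N \<Longrightarrow> x \<in> carrier M \<Longrightarrow> h x \<in> carrier N"
  and mod_hom_add:
    "h \<in> mod_hom R M N \<Longrightarrow> x \<in> carrier M \<Longrightarrow> y \<in> carrier M \<Longrightarrow> h (x \<oplus>\<^bsub>M\<^esub> y) = h x \<oplus>\<^bsub>N\<^esub> h y"
  and mod_hom_smult:
    "h \<in> mod_hom R M N \<Longrightarrow> r \<in> carrier R \<Longrightarrow> x \<in> carrier M \<Longrightarrow> h (r \<odot>\<^bsub>M\<^esub> x) = r \<odot>\<^bsub>N\<^esub> h x"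
  by (auto simp: mod_hom_def)

lemma mod_hom_lin:
  assumes "h \<in> mod_hom R M N" "left_module R M" "r \<in> carrier R" "x \<in> carrier M" "y \<in> carrier M"
  shows "h (r \<odot>\<^bsub>M\<^esub> x \<oplus>\<^bsub>M\<^esub> y) = r \<odot>\<^bsub>N\<^esub> h x \<oplus>\<^bsub>N\<^esub> h y"
  using assms by (simp add: mod_hom_add[OF assms(1)] mod_hom_smult[OF assms(1)] left_module.smult_closed)

lemma mod_hom_zero:
  assumes h: "h \<in> mod_hom R M N" and "left_module R M" "left_module R N"
  shows "h \<zero>\<^bsub>M\<^esub> = \<zero>\<^bsub>N\<^esub>"
proof -
  interpret M: left_module R M by fact
  interpret N: left_module R N by fact
  have "h \<zero>\<^bsub>M\<^esub> \<oplus>\<^bsub>N\<^esub> h \<zero>\<^bsub>M\<^esub> = h \<zero>\<^bsub>M\<^esub> \<oplus>\<^bsub>N\<^esub> \<zero>\<^bsub>N\<^esub>"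
    using mod_hom_add[OF h, of "\<zero>\<^bsub>M\<^esub>" "\<zero>\<^bsub>M\<^esub>"] mod_hom_closed[OF h] by simp
  then show ?thesis
    using mod_hom_closed[OF h] by simp
qed

lemma mod_hom_minus:
  assumes h: "h \<in> mod_hom R M N" and "left_module R M" "left_module R N" and x: "x \<in> carrier M"
  shows "h (\<ominus>\<^bsub>M\<^esub> x) = \<ominus>\<^bsub>N\<^esub> h x"
proof -
  interpret M: left_module R M by fact
  interpret N: left_module R N by fact
  have "h (\<ominus>\<^bsub>M\<^esub> x) \<oplus>\<^bsub>N\<^esub> h x = \<zero>\<^bsub>N\<^esub>"
    using mod_hom_add[OF h, of "\<ominus>\<^bsub>M\<^esub> x" x] x by (simp add: M.M.l_neg mod_hom_zero[OF assms(1-3)])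
  then show ?thesis using mod_hom_closed[OF h] x by (simp add: N.M.minus_equality)
qed

lemma mod_hom_comp:
  assumes "h \<in> mod_hom R M N" "k \<in> mod_hom R N P"
  shows "(\<lambda>x. k (h x)) \<in> mod_hom R M P"
  using assms by (auto simp: mod_hom_def Pi_iff)

lemma mod_hom_cong:
  assumes "left_module R M" "h \<in> mod_hom R M N" "\<And>x. x \<in> carrier M \<Longrightarrow> k x = h x"
  shows "k \<in> mod_hom R M N"
  using assms left_module.smult_closed[OF assms(1)]
    abelian_group.axioms(1)[OF left_module.axioms(2)[OF assms(1)], THEN abelian_monoid.a_closed]
  by (auto simp: mod_hom_def Pi_iff)

lemma a_kernel_iff: "x \<in> a_kernel M N h \<longleftrightarrow> x \<in> carrier M \<and> h x = \<zero>\<^bsub>N\<^esub>"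
  by (simp add: a_kernel_def kernel_def)

lemma left_module_surj_image:
  assumes "left_module R M" and h: "h \<in> mod_hom R M N" and surj: "h ` carrier M = carrier N"
    and zero: "\<zero>\<^bsub>N\<^esub> = h \<zero>\<^bsub>M\<^esub>"
  shows "left_module R N"
proof -
  interpret M: left_module R M by fact
  note hom = mod_hom_add[OF h, symmetric] mod_hom_smult[OF h, symmetric]
  show ?thesis
  proof (rule left_moduleI[OF M.R.ring_axioms])
    show "abelian_group N"
    proof (rule abelian_groupI)
      fix x assume "x \<in> carrier N"
      then obtain x' where x': "x' \<in> carrier M" "x = h x'" by (auto simp: surj[symmetric])
      then have "h (\<ominus>\<^bsub>M\<^esub> x') \<in> carrier N" "h (\<ominus>\<^bsub>M\<^esub> x') \<oplus>\<^bsub>N\<^esub> x = \<zero>\<^bsub>N\<^esub>"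
        by (auto simp: zero hom M.M.l_neg mod_hom_closed[OF h])
      then show "\<exists>y\<in>carrier N. y \<oplus>\<^bsub>N\<^esub> x = \<zero>\<^bsub>N\<^esub>" by blast
    qed (auto simp: surj[symmetric] hom zero M.M.a_ac)
  qed (auto simp: surj[symmetric] hom M.smult_l_distr M.smult_r_distr M.smult_assoc1)
qed

lemma left_module_submodule:
  assumes "left_module R M" "submodule H R M"
  shows "left_module R (M\<lparr>carrier := H\<rparr>)"
proof -
  interpret M: left_module R M by fact
  interpret H: submodule H R M by fact
  have sub: "x \<in> H \<Longrightarrow> x \<in> carrier M" for x using H.subset by auto
  show ?thesis
  proof (rule left_moduleI[OF M.R.ring_axioms])
    show "abelian_group (M\<lparr>carrier := H\<rparr>)"
    proof (rule abelian_groupI)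
      fix x assume "x \<in> carrier (M\<lparr>carrier := H\<rparr>)"
      then have "\<ominus>\<^bsub>M\<^esub> x \<in> H" "\<ominus>\<^bsub>M\<^esub> x \<oplus>\<^bsub>M\<^esub> x = \<zero>\<^bsub>M\<^esub>"
        using H.m_inv_closed[of x] sub by (auto simp: a_inv_def[symmetric] M.M.l_neg)
      then show "\<exists>y\<in>carrier (M\<lparr>carrier := H\<rparr>). y \<oplus>\<^bsub>M\<lparr>carrier := H\<rparr>\<^esub> x = \<zero>\<^bsub>M\<lparr>carrier := H\<rparr>\<^esub>"
        by auto
    qed (use H.m_closed H.one_closed in \<open>auto simp: sub M.M.a_ac\<close>)
  qed (auto simp: sub M.smult_l_distr M.smult_r_distr M.smult_assoc1)
qed

context
  fixes R :: "('r, 'q) ring_scheme" and M :: "('r, 'a) module" and N :: "'a set"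
  assumes M: "left_module R M" and N: "submodule N R M"
begin

interpretation M: left_module R M by (fact M)
interpretation N: submodule N R M by (fact N)
interpretation N: abelian_subgroup N M
  by (rule abelian_subgroupI3)
    (auto intro: additive_subgroupI N.subgroup_axioms M.M.abelian_group_axioms)

lemma quot_map_eq_iff:
  assumes "x \<in> carrier M" "y \<in> carrier M"
  shows "N +>\<^bsub>M\<^esub> x = N +>\<^bsub>M\<^esub> y \<longleftrightarrow> x \<ominus>\<^bsub>M\<^esub> y \<in> N"
proof
  assume "N +>\<^bsub>M\<^esub> x = N +>\<^bsub>M\<^esub> y"
  then have "N +>\<^bsub>M\<^esub> (x \<oplus>\<^bsub>M\<^esub> \<ominus>\<^bsub>M\<^esub> y) = N"
    using M.M.a_coset_add_inv2 assms N.a_subset by blast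
  then show "x \<ominus>\<^bsub>M\<^esub> y \<in> N"
    using assms N.subgroup_axioms M.M.a_coset_join1 by (simp add: M.M.minus_eq)
next
  assume "x \<ominus>\<^bsub>M\<^esub> y \<in> N"
  then have "N +>\<^bsub>M\<^esub> (x \<oplus>\<^bsub>M\<^esub> \<ominus>\<^bsub>M\<^esub> y) = N"
    using assms N.subgroup_axioms M.M.a_coset_join2 by (simp add: M.M.minus_eq)
  then show "N +>\<^bsub>M\<^esub> x = N +>\<^bsub>M\<^esub> y" using M.M.a_coset_add_inv1 assms N.a_subset by blast
qed

lemma quot_map_hom: "(\<lambda>x. N +>\<^bsub>M\<^esub> x) \<in> mod_hom R M (mod_quot M N)"
proof -
  have smult: "(\<Union>z\<in>N +>\<^bsub>M\<^esub> x. N +>\<^bsub>M\<^esub> (r \<odot>\<^bsub>M\<^esub> z)) = N +>\<^bsub>M\<^esub> (r \<odot>\<^bsub>M\<^esub> x)"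
    if "r \<in> carrier R" "x \<in> carrier M" for r x
  proof -
    have "N +>\<^bsub>M\<^esub> (r \<odot>\<^bsub>M\<^esub> z) = N +>\<^bsub>M\<^esub> (r \<odot>\<^bsub>M\<^esub> x)" if z: "z \<in> N +>\<^bsub>M\<^esub> x" for z
    proof -
      obtain n where n: "n \<in> N" "z = n \<oplus>\<^bsub>M\<^esub> x" using z by (auto simp: a_r_coset_def')
      then have nc: "n \<in> carrier M" using N.a_subset by auto
      have "r \<odot>\<^bsub>M\<^esub> z \<ominus>\<^bsub>M\<^esub> r \<odot>\<^bsub>M\<^esub> x = r \<odot>\<^bsub>M\<^esub> n"
        using \<open>r \<in> carrier R\<close> \<open>x \<in> carrier M\<close> n nc
        by (simp add: M.smult_r_distr M.M.minus_eq M.M.a_assoc M.M.r_neg)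
      then show ?thesis using \<open>r \<in> carrier R\<close> \<open>x \<in> carrier M\<close> n nc
        by (subst quot_map_eq_iff) auto
    qed
    then show ?thesis using N.a_rcos_self[OF \<open>x \<in> carrier M\<close>] by blast
  qed
  show ?thesis
    unfolding mod_hom_def mod_quot_def
    by (auto simp: smult N.a_rcos_sum M.M.a_rcosetsI N.a_subset)
qed

lemma quot_map_surj: "(\<lambda>x. N +>\<^bsub>M\<^esub> x) ` carrier M = carrier (mod_quot M N)"
  by (auto simp: mod_quot_def A_RCOSETS_def')

lemma quot_zero: "\<zero>\<^bsub>mod_quot M N\<^esub> = N +>\<^bsub>M\<^esub> \<zero>\<^bsub>M\<^esub>"
  using N.a_subset by (simp add: mod_quot_def)

lemma left_module_quot: "left_module R (mod_quot M N)"
  using M quot_map_hom quot_map_surj quot_zero by (rule left_module_surj_image)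

end

lemma mod_prod_simps [simp]:
  "carrier (mod_prod M N) = carrier M \<times> carrier N"
  "\<zero>\<^bsub>mod_prod M N\<^esub> = (\<zero>\<^bsub>M\<^esub>, \<zero>\<^bsub>N\<^esub>)"
  "p \<oplus>\<^bsub>mod_prod M N\<^esub> p' = (fst p \<oplus>\<^bsub>M\<^esub> fst p', snd p \<oplus>\<^bsub>N\<^esub> snd p')"
  "r \<odot>\<^bsub>mod_prod M N\<^esub> p = (r \<odot>\<^bsub>M\<^esub> fst p, r \<odot>\<^bsub>N\<^esub> snd p)"
  by (auto simp: mod_prod_def case_prod_beta)

lemma left_module_prod:
  assumes "left_module R M" "left_module R N"
  shows "left_module R (mod_prod M N)"
proof -
  interpret M: left_module R M by fact
  interpret N: left_module R N by fact
  show ?thesis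
  proof (rule left_moduleI[OF M.R.ring_axioms])
    show "abelian_group (mod_prod M N)"
    proof (rule abelian_groupI)
      fix p assume "p \<in> carrier (mod_prod M N)"
      then have "(\<ominus>\<^bsub>M\<^esub> fst p, \<ominus>\<^bsub>N\<^esub> snd p) \<in> carrier (mod_prod M N)"
        "(\<ominus>\<^bsub>M\<^esub> fst p, \<ominus>\<^bsub>N\<^esub> snd p) \<oplus>\<^bsub>mod_prod M N\<^esub> p = \<zero>\<^bsub>mod_prod M N\<^esub>"
        by (auto simp: M.M.l_neg N.M.l_neg)
      then show "\<exists>y\<in>carrier (mod_prod M N). y \<oplus>\<^bsub>mod_prod M N\<^esub> p = \<zero>\<^bsub>mod_prod M N\<^esub>" by blast
    qed (auto simp: M.M.a_ac N.M.a_ac)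
  qed (auto simp: M.smult_l_distr M.smult_r_distr M.smult_assoc1
      N.smult_l_distr N.smult_r_distr N.smult_assoc1)
qed

lemma mod_prod_minus:
  assumes "left_module R M" "left_module R N" "p \<in> carrier (mod_prod M N)"
  shows "\<ominus>\<^bsub>mod_prod M N\<^esub> p = (\<ominus>\<^bsub>M\<^esub> fst p, \<ominus>\<^bsub>N\<^esub> snd p)"
proof -
  interpret M: left_module R M by fact
  interpret N: left_module R N by fact
  interpret P: left_module R "mod_prod M N" using assms(1,2) by (rule left_module_prod)
  show ?thesis
    using assms(3) by (intro P.M.minus_equality) (auto simp: M.M.l_neg N.M.l_neg)
qed

lemma direct_sum_simps [simp]:
  "\<zero>\<^bsub>direct_sum I M\<^esub> = (\<lambda>i\<in>I. \<zero>\<^bsub>M i\<^esub>)"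
  "v \<oplus>\<^bsub>direct_sum I M\<^esub> w = (\<lambda>i\<in>I. v i \<oplus>\<^bsub>M i\<^esub> w i)"
  "r \<odot>\<^bsub>direct_sum I M\<^esub> v = (\<lambda>i\<in>I. r \<odot>\<^bsub>M i\<^esub> v i)"
  by (auto simp: direct_sum_def)

lemma in_direct_sum_iff:
  "v \<in> carrier (direct_sum I M) \<longleftrightarrow>
     v \<in> (\<Pi>\<^sub>E i\<in>I. carrier (M i)) \<and> finite {i \<in> I. v i \<noteq> \<zero>\<^bsub>M i\<^esub>}"
  by (simp add: direct_sum_def)

lemma direct_sumI:
  assumes "\<And>i. i \<in> I \<Longrightarrow> v i \<in> carrier (M i)" "v \<in> extensional I"
    and "finite F" "\<And>i. \<lbrakk>i \<in> I; i \<notin> F\<rbrakk> \<Longrightarrow> v i = \<zero>\<^bsub>M i\<^esub>"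
  shows "v \<in> carrier (direct_sum I M)"
  using assms finite_subset[of "{i \<in> I. v i \<noteq> \<zero>\<^bsub>M i\<^esub>}" F]
  by (auto simp: in_direct_sum_iff PiE_iff)

lemma direct_sum_closed: "v \<in> carrier (direct_sum I M) \<Longrightarrow> i \<in> I \<Longrightarrow> v i \<in> carrier (M i)"
  and direct_sum_extensional: "v \<in> carrier (direct_sum I M) \<Longrightarrow> v \<in> extensional I"
  and direct_sum_finite: "v \<in> carrier (direct_sum I M) \<Longrightarrow> finite {i \<in> I. v i \<noteq> \<zero>\<^bsub>M i\<^esub>}"
  by (auto simp: in_direct_sum_iff PiE_iff)

lemma left_module_direct_sum:
  assumes R: "ring R" and M: "\<And>i. i \<in> I \<Longrightarrow> left_module R (M i)"
  shows "left_module R (direct_sum I M)"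
proof -
  note l = left_module.smult_closed[OF M] left_module.smult_l_distr[OF M]
    left_module.smult_r_distr[OF M] left_module.smult_assoc1[OF M] left_module.smult_one[OF M]
  have a: "abelian_group (M i)" if "i \<in> I" for i
    using M[OF that] by (simp add: left_module_def)
  note m = abelian_group.axioms(1)[OF a]
  note g = abelian_monoid.a_closed[OF m] abelian_monoid.zero_closed[OF m]
    abelian_group.a_inv_closed[OF a] abelian_monoid.l_zero[OF m] abelian_monoid.r_zero[OF m]
    abelian_group.l_neg[OF a]
  note c = direct_sum_closed[where I = I and M = M]
  have minus_zero: "\<ominus>\<^bsub>M i\<^esub> \<zero>\<^bsub>M i\<^esub> = \<zero>\<^bsub>M i\<^esub>" if "i \<in> I" for i
    using that by (intro abelian_group.minus_equality[OF a]) (auto simp: g)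
  show ?thesis
  proof (rule left_moduleI[OF R])
    show "abelian_group (direct_sum I M)"
    proof (rule abelian_groupI)
      fix v w assume vw: "v \<in> carrier (direct_sum I M)" "w \<in> carrier (direct_sum I M)"
      show "v \<oplus>\<^bsub>direct_sum I M\<^esub> w \<in> carrier (direct_sum I M)"
        by (rule direct_sumI[where F = "{i \<in> I. v i \<noteq> \<zero>\<^bsub>M i\<^esub>} \<union> {i \<in> I. w i \<noteq> \<zero>\<^bsub>M i\<^esub>}"])
          (use vw in \<open>auto simp: c g direct_sum_finite\<close>)
      show "v \<oplus>\<^bsub>direct_sum I M\<^esub> w = w \<oplus>\<^bsub>direct_sum I M\<^esub> v"
        using vw by (auto simp: c abelian_monoid.a_comm[OF m] intro!: restrict_ext)
    next
      fix u v w assume "u \<in> carrier (direct_sum I M)" "v \<in> carrier (direct_sum I M)"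
        "w \<in> carrier (direct_sum I M)"
      then show "u \<oplus>\<^bsub>direct_sum I M\<^esub> v \<oplus>\<^bsub>direct_sum I M\<^esub> w
          = u \<oplus>\<^bsub>direct_sum I M\<^esub> (v \<oplus>\<^bsub>direct_sum I M\<^esub> w)"
        by (auto simp: c abelian_monoid.a_assoc[OF m] intro!: restrict_ext)
    next
      show "\<zero>\<^bsub>direct_sum I M\<^esub> \<in> carrier (direct_sum I M)"
        by (rule direct_sumI[where F = "{}"]) (auto simp: g)
    next
      fix v assume v: "v \<in> carrier (direct_sum I M)"
      show "\<zero>\<^bsub>direct_sum I M\<^esub> \<oplus>\<^bsub>direct_sum I M\<^esub> v = v"
        using v direct_sum_extensional[OF v] by (auto simp: c g extensional_def)
      have "(\<lambda>i\<in>I. \<ominus>\<^bsub>M i\<^esub> v i) \<in> carrier (direct_sum I M)"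
        by (rule direct_sumI[where F = "{i \<in> I. v i \<noteq> \<zero>\<^bsub>M i\<^esub>}"])
          (use v in \<open>auto simp: c g minus_zero direct_sum_finite\<close>)
      moreover have "(\<lambda>i\<in>I. \<ominus>\<^bsub>M i\<^esub> v i) \<oplus>\<^bsub>direct_sum I M\<^esub> v = \<zero>\<^bsub>direct_sum I M\<^esub>"
        using v by (auto simp: c g)
      ultimately show "\<exists>w\<in>carrier (direct_sum I M). w \<oplus>\<^bsub>direct_sum I M\<^esub> v = \<zero>\<^bsub>direct_sum I M\<^esub>"
        by blast
    qed
  next
    fix r v assume "r \<in> carrier R" and v: "v \<in> carrier (direct_sum I M)"
    then show "r \<odot>\<^bsub>direct_sum I M\<^esub> v \<in> carrier (direct_sum I M)"
      by (intro direct_sumI[where F = "{i \<in> I. v i \<noteq> \<zero>\<^bsub>M i\<^esub>}"])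
        (use v in \<open>auto simp: c l direct_sum_finite left_module.smult_zero_right[OF M]\<close>)
  next
    fix v assume v: "v \<in> carrier (direct_sum I M)"
    show "\<one>\<^bsub>R\<^esub> \<odot>\<^bsub>direct_sum I M\<^esub> v = v"
      using v direct_sum_extensional[OF v] by (auto simp: c l extensional_def)
  qed (auto simp: c l intro!: restrict_ext)
qed

section \<open>Short exact sequences and factor systems\<close>

locale short_exact_sequence =
  Y: left_module R Y + X: left_module R X + E: left_module R "mid S"
  for R :: "('r, 'q) ring_scheme" and Y :: "('r, 'y) module" and X :: "('r, 'x) module"
    and S :: "('r, 'y, 'e, 'x) ses" +
  assumes short_exact: "short_exact R Y X S"
begin

lemma inc_hom: "inc S \<in> mod_hom R Y (mid S)"
  and prj_hom: "prj S \<in> mod_hom R (mid S) X"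
  and inc_inj: "inj_on (inc S) (carrier Y)"
  and inc_image: "inc S ` carrier Y = a_kernel (mid S) X (prj S)"
  and prj_image: "prj S ` carrier (mid S) = carrier X"
  using short_exact by (auto simp: short_exact_def)

lemmas inc_closed [simp, intro] = mod_hom_closed[OF inc_hom]
  and inc_add = mod_hom_add[OF inc_hom]
  and inc_smult = mod_hom_smult[OF inc_hom]
  and inc_zero = mod_hom_zero[OF inc_hom Y.left_module_axioms E.left_module_axioms]
  and inc_minus = mod_hom_minus[OF inc_hom Y.left_module_axioms E.left_module_axioms]
  and prj_closed [simp, intro] = mod_hom_closed[OF prj_hom]
  and prj_add = mod_hom_add[OF prj_hom]
  and prj_smult = mod_hom_smult[OF prj_hom]
  and prj_zero = mod_hom_zero[OF prj_hom E.left_module_axioms X.left_module_axioms]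
  and prj_minus = mod_hom_minus[OF prj_hom E.left_module_axioms X.left_module_axioms]

lemma prj_inc [simp]: "y \<in> carrier Y \<Longrightarrow> prj S (inc S y) = \<zero>\<^bsub>X\<^esub>"
  using inc_image by (auto simp: a_kernel_iff)

lemma exactE:
  assumes "e \<in> carrier (mid S)" "prj S e = \<zero>\<^bsub>X\<^esub>"
  obtains y where "y \<in> carrier Y" "e = inc S y"
  using assms inc_image by (auto simp: a_kernel_iff set_eq_iff image_iff)

lemma same_prjE:
  assumes "e \<in> carrier (mid S)" "e' \<in> carrier (mid S)" "prj S e = prj S e'"
  obtains y where "y \<in> carrier Y" "e = e' \<oplus>\<^bsub>mid S\<^esub> inc S y"
proof -
  have "prj S (\<ominus>\<^bsub>mid S\<^esub> e' \<oplus>\<^bsub>mid S\<^esub> e) = \<zero>\<^bsub>X\<^esub>"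
    using assms by (simp add: prj_add prj_minus X.M.l_neg)
  then obtain y where "y \<in> carrier Y" "\<ominus>\<^bsub>mid S\<^esub> e' \<oplus>\<^bsub>mid S\<^esub> e = inc S y"
    using assms exactE[of "\<ominus>\<^bsub>mid S\<^esub> e' \<oplus>\<^bsub>mid S\<^esub> e"] by auto
  then show thesis using assms E.M.r_neg2[of e' e] by (intro that[of y]) auto
qed

lemma inc_eq_iff: "y \<in> carrier Y \<Longrightarrow> y' \<in> carrier Y \<Longrightarrow> inc S y = inc S y' \<longleftrightarrow> y = y'"
  using inc_inj by (auto simp: inj_on_def)

end

lemma short_exact_sequenceI:
  "left_module R Y \<Longrightarrow> left_module R X \<Longrightarrow> short_exact R Y X S \<Longrightarrow> short_exact_sequence R Y X S"
  by (simp add: short_exact_sequence_def short_exact_sequence_axioms_def short_exact_def)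

lemma short_exactI:
  assumes "left_module R Y" "left_module R X" "left_module R (mid S)"
    and "inc S \<in> mod_hom R Y (mid S)" "prj S \<in> mod_hom R (mid S) X"
    and "\<And>y. y \<in> carrier Y \<Longrightarrow> inc S y = \<zero>\<^bsub>mid S\<^esub> \<Longrightarrow> y = \<zero>\<^bsub>Y\<^esub>"
    and "\<And>y. y \<in> carrier Y \<Longrightarrow> prj S (inc S y) = \<zero>\<^bsub>X\<^esub>"
    and "\<And>e. e \<in> carrier (mid S) \<Longrightarrow> prj S e = \<zero>\<^bsub>X\<^esub> \<Longrightarrow> \<exists>y\<in>carrier Y. e = inc S y"
    and "\<And>x. x \<in> carrier X \<Longrightarrow> \<exists>e\<in>carrier (mid S). prj S e = x"
  shows "short_exact R Y X S"
proof -
  interpret Y: left_module R Y by fact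
  interpret E: left_module R "mid S" by fact
  have "inj_on (inc S) (carrier Y)"
  proof (rule inj_onI)
    fix y y' assume y: "y \<in> carrier Y" "y' \<in> carrier Y" "inc S y = inc S y'"
    then have "inc S (y \<ominus>\<^bsub>Y\<^esub> y') = \<zero>\<^bsub>mid S\<^esub>"
      using mod_hom_closed[OF assms(4)]
      by (simp add: Y.M.minus_eq mod_hom_add[OF assms(4)] mod_hom_minus[OF assms(4,1,3)] E.M.r_neg)
    then have "y \<ominus>\<^bsub>Y\<^esub> y' = \<zero>\<^bsub>Y\<^esub>" using assms(6) y by simp
    then show "y = y'" using y by (metis Y.diff_eq_zero_iff)
  qed
  moreover have "inc S ` carrier Y = a_kernel (mid S) X (prj S)"
  proof (intro equalityI subsetI)
    show "e \<in> a_kernel (mid S) X (prj S)" if "e \<in> inc S ` carrier Y" for e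
      using that assms(7) mod_hom_closed[OF assms(4)] by (auto simp: a_kernel_iff)
    show "e \<in> inc S ` carrier Y" if "e \<in> a_kernel (mid S) X (prj S)" for e
      using assms(8)[of e] that unfolding a_kernel_iff image_iff by blast
  qed
  moreover have "prj S ` carrier (mid S) = carrier X"
    using assms(9) mod_hom_closed[OF assms(5)] by auto
  ultimately show ?thesis using assms(3-5) by (simp add: short_exact_def)
qed

definition sect_of :: "('r, 'x) module \<Rightarrow> ('r, 'y, 'e, 'x) ses \<Rightarrow> ('x \<Rightarrow> 'e) \<Rightarrow> bool" where
  "sect_of X S s \<longleftrightarrow> (\<forall>x\<in>carrier X. s x \<in> carrier (mid S) \<and> prj S (s x) = x)"

text \<open>A single function \<open>c\<close> records the failure of a set-theoretic section to be additive and to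
  commute with scalars; taking \<open>r = 1\<close> or \<open>x' = 0\<close> recovers the two usual factor sets.\<close>

definition factor_system :: "('r, 'q) ring_scheme \<Rightarrow> ('r, 'y) module \<Rightarrow> ('r, 'x) module
    \<Rightarrow> ('r, 'y, 'e, 'x) ses \<Rightarrow> ('x \<Rightarrow> 'e) \<Rightarrow> ('r \<Rightarrow> 'x \<Rightarrow> 'x \<Rightarrow> 'y) \<Rightarrow> bool" where
  "factor_system R Y X S s c \<longleftrightarrow> sect_of X S s \<and>
     (\<forall>r\<in>carrier R. \<forall>x\<in>carrier X. \<forall>x'\<in>carrier X. c r x x' \<in> carrier Y \<and>
        r \<odot>\<^bsub>mid S\<^esub> s x \<oplus>\<^bsub>mid S\<^esub> s x' = s (r \<odot>\<^bsub>X\<^esub> x \<oplus>\<^bsub>X\<^esub> x') \<oplus>\<^bsub>mid S\<^esub> inc S (c r x x'))"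

definition represents :: "('r, 'q) ring_scheme \<Rightarrow> ('r, 'y) module \<Rightarrow> ('r, 'x) module
    \<Rightarrow> ('r, 'y, 'e, 'x) ses \<Rightarrow> ('r \<Rightarrow> 'x \<Rightarrow> 'x \<Rightarrow> 'y) \<Rightarrow> bool" where
  "represents R Y X S c \<longleftrightarrow> (\<exists>s. factor_system R Y X S s c)"

lemma factor_systemD:
  assumes "factor_system R Y X S s c"
  shows "x \<in> carrier X \<Longrightarrow> s x \<in> carrier (mid S)"
    and "x \<in> carrier X \<Longrightarrow> prj S (s x) = x"
    and "\<lbrakk>r \<in> carrier R; x \<in> carrier X; x' \<in> carrier X\<rbrakk> \<Longrightarrow> c r x x' \<in> carrier Y"
    and "\<lbrakk>r \<in> carrier R; x \<in> carrier X; x' \<in> carrier X\<rbrakk> \<Longrightarrow>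
      r \<odot>\<^bsub>mid S\<^esub> s x \<oplus>\<^bsub>mid S\<^esub> s x' = s (r \<odot>\<^bsub>X\<^esub> x \<oplus>\<^bsub>X\<^esub> x') \<oplus>\<^bsub>mid S\<^esub> inc S (c r x x')"
  using assms by (auto simp: factor_system_def sect_of_def)

lemma representsI:
  assumes "\<And>x. x \<in> carrier X \<Longrightarrow> s x \<in> carrier (mid S)"
    and "\<And>x. x \<in> carrier X \<Longrightarrow> prj S (s x) = x"
    and "\<And>r x x'. \<lbrakk>r \<in> carrier R; x \<in> carrier X; x' \<in> carrier X\<rbrakk> \<Longrightarrow> c r x x' \<in> carrier Y"
    and "\<And>r x x'. \<lbrakk>r \<in> carrier R; x \<in> carrier X; x' \<in> carrier X\<rbrakk> \<Longrightarrow>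
      r \<odot>\<^bsub>mid S\<^esub> s x \<oplus>\<^bsub>mid S\<^esub> s x' = s (r \<odot>\<^bsub>X\<^esub> x \<oplus>\<^bsub>X\<^esub> x') \<oplus>\<^bsub>mid S\<^esub> inc S (c r x x')"
  shows "represents R Y X S c"
  unfolding represents_def factor_system_def using assms
  by (intro exI[of _ s]) (auto simp: sect_of_def)

lemma represents_closed:
  "represents R Y X S c \<Longrightarrow> r \<in> carrier R \<Longrightarrow> x \<in> carrier X \<Longrightarrow> x' \<in> carrier X \<Longrightarrow> c r x x' \<in> carrier Y"
  by (auto simp: represents_def factor_system_def)

lemma represents_cong:
  assumes "represents R Y X S c"
    and "\<And>r x x'. \<lbrakk>r \<in> carrier R; x \<in> carrier X; x' \<in> carrier X\<rbrakk> \<Longrightarrow> d r x x' = c r x x'"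
  shows "represents R Y X S d"
  using assms by (simp add: represents_def factor_system_def)

context short_exact_sequence
begin

lemma ex_sect: "\<exists>s. sect_of X S s"
proof -
  have "\<forall>x\<in>carrier X. \<exists>e. e \<in> carrier (mid S) \<and> prj S e = x"
    by (metis imageE prj_image)
  then show ?thesis unfolding sect_of_def by (rule bchoice)
qed

lemma ex_factor_system:
  assumes "sect_of X S s"
  shows "\<exists>c. factor_system R Y X S s c"
proof -
  have s: "\<And>x. x \<in> carrier X \<Longrightarrow> s x \<in> carrier (mid S)" "\<And>x. x \<in> carrier X \<Longrightarrow> prj S (s x) = x"
    using assms by (auto simp: sect_of_def)
  have "\<exists>y. y \<in> carrier Y \<and>
      r \<odot>\<^bsub>mid S\<^esub> s x \<oplus>\<^bsub>mid S\<^esub> s x' = s (r \<odot>\<^bsub>X\<^esub> x \<oplus>\<^bsub>X\<^esub> x') \<oplus>\<^bsub>mid S\<^esub> inc S y"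
    if "r \<in> carrier R" "x \<in> carrier X" "x' \<in> carrier X" for r x x'
  proof -
    have "r \<odot>\<^bsub>mid S\<^esub> s x \<oplus>\<^bsub>mid S\<^esub> s x' \<in> carrier (mid S)" "s (r \<odot>\<^bsub>X\<^esub> x \<oplus>\<^bsub>X\<^esub> x') \<in> carrier (mid S)"
      "prj S (r \<odot>\<^bsub>mid S\<^esub> s x \<oplus>\<^bsub>mid S\<^esub> s x') = prj S (s (r \<odot>\<^bsub>X\<^esub> x \<oplus>\<^bsub>X\<^esub> x'))"
      using that s by (simp_all add: prj_add prj_smult)
    then show ?thesis by (rule same_prjE) blast
  qed
  then obtain c where "\<And>r x x'. \<lbrakk>r \<in> carrier R; x \<in> carrier X; x' \<in> carrier X\<rbrakk> \<Longrightarrow>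
      c r x x' \<in> carrier Y \<and>
      r \<odot>\<^bsub>mid S\<^esub> s x \<oplus>\<^bsub>mid S\<^esub> s x' = s (r \<odot>\<^bsub>X\<^esub> x \<oplus>\<^bsub>X\<^esub> x') \<oplus>\<^bsub>mid S\<^esub> inc S (c r x x')"
    by metis
  then show ?thesis using assms unfolding factor_system_def by blast
qed

lemma ex_represents: "\<exists>c. represents R Y X S c \<and> (\<forall>r\<in>carrier R. c r \<zero>\<^bsub>X\<^esub> \<zero>\<^bsub>X\<^esub> = \<zero>\<^bsub>Y\<^esub>)"
proof -
  obtain s' where s': "sect_of X S s'" using ex_sect by blast
  define s where "s = s'(\<zero>\<^bsub>X\<^esub> := \<zero>\<^bsub>mid S\<^esub>)"
  have s: "sect_of X S s" and s0: "s \<zero>\<^bsub>X\<^esub> = \<zero>\<^bsub>mid S\<^esub>"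
    using s' by (auto simp: sect_of_def s_def prj_zero)
  obtain c where c: "factor_system R Y X S s c" using ex_factor_system[OF s] by blast
  have "c r \<zero>\<^bsub>X\<^esub> \<zero>\<^bsub>X\<^esub> = \<zero>\<^bsub>Y\<^esub>" if r: "r \<in> carrier R" for r
    using factor_systemD(3,4)[OF c r X.M.zero_closed X.M.zero_closed] r s0
      inc_eq_iff[of "c r \<zero>\<^bsub>X\<^esub> \<zero>\<^bsub>X\<^esub>" "\<zero>\<^bsub>Y\<^esub>"]
    by (simp add: inc_zero)
  then show ?thesis using c by (auto simp: represents_def)
qed

lemma sect_bij:
  assumes "sect_of X S s"
  shows "bij_betw (\<lambda>(x, y). s x \<oplus>\<^bsub>mid S\<^esub> inc S y) (carrier X \<times> carrier Y) (carrier (mid S))"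
proof -
  have s: "\<And>x. x \<in> carrier X \<Longrightarrow> s x \<in> carrier (mid S)" "\<And>x. x \<in> carrier X \<Longrightarrow> prj S (s x) = x"
    using assms by (auto simp: sect_of_def)
  have prj: "prj S (s x \<oplus>\<^bsub>mid S\<^esub> inc S y) = x" if "x \<in> carrier X" "y \<in> carrier Y" for x y
    using that s by (simp add: prj_add)
  have "(x, y) = (x', y')"
    if "x \<in> carrier X" "y \<in> carrier Y" "x' \<in> carrier X" "y' \<in> carrier Y"
      "s x \<oplus>\<^bsub>mid S\<^esub> inc S y = s x' \<oplus>\<^bsub>mid S\<^esub> inc S y'" for x y x' y'
  proof -
    have "x = x'" using prj that by metis
    then show ?thesis using that s by (simp add: inc_eq_iff)
  qed
  moreover have "\<exists>x\<in>carrier X. \<exists>y\<in>carrier Y. e = s x \<oplus>\<^bsub>mid S\<^esub> inc S y"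
    if e: "e \<in> carrier (mid S)" for e
    using same_prjE[of e "s (prj S e)"] s e by (metis prj_closed)
  ultimately show ?thesis using s by (fastforce simp: bij_betw_def inj_on_def image_iff)
qed

context
  fixes s c assumes sc: "factor_system R Y X S s c"
begin

lemma factor_system_lin:
  assumes "r \<in> carrier R" "x \<in> carrier X" "x' \<in> carrier X" "y \<in> carrier Y" "y' \<in> carrier Y"
  shows "r \<odot>\<^bsub>mid S\<^esub> (s x \<oplus>\<^bsub>mid S\<^esub> inc S y) \<oplus>\<^bsub>mid S\<^esub> (s x' \<oplus>\<^bsub>mid S\<^esub> inc S y')
    = s (r \<odot>\<^bsub>X\<^esub> x \<oplus>\<^bsub>X\<^esub> x') \<oplus>\<^bsub>mid S\<^esub> inc S (c r x x' \<oplus>\<^bsub>Y\<^esub> (r \<odot>\<^bsub>Y\<^esub> y \<oplus>\<^bsub>Y\<^esub> y'))"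
proof -
  note s = factor_systemD(1,3)[OF sc]
  have "r \<odot>\<^bsub>mid S\<^esub> (s x \<oplus>\<^bsub>mid S\<^esub> inc S y) \<oplus>\<^bsub>mid S\<^esub> (s x' \<oplus>\<^bsub>mid S\<^esub> inc S y')
    = (r \<odot>\<^bsub>mid S\<^esub> s x \<oplus>\<^bsub>mid S\<^esub> s x') \<oplus>\<^bsub>mid S\<^esub> (r \<odot>\<^bsub>mid S\<^esub> inc S y \<oplus>\<^bsub>mid S\<^esub> inc S y')"
    using assms s by (simp add: E.smult_r_distr E.M.a_ac)
  also have "\<dots> = s (r \<odot>\<^bsub>X\<^esub> x \<oplus>\<^bsub>X\<^esub> x') \<oplus>\<^bsub>mid S\<^esub> inc S (c r x x' \<oplus>\<^bsub>Y\<^esub> (r \<odot>\<^bsub>Y\<^esub> y \<oplus>\<^bsub>Y\<^esub> y'))"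
    unfolding factor_systemD(4)[OF sc assms(1-3)]
    using assms s by (simp add: inc_add inc_smult E.M.a_assoc)
  finally show ?thesis .
qed

lemma factor_system_inc:
  assumes "y \<in> carrier Y"
  shows "inc S y = s \<zero>\<^bsub>X\<^esub> \<oplus>\<^bsub>mid S\<^esub> inc S (\<ominus>\<^bsub>Y\<^esub> c \<one>\<^bsub>R\<^esub> \<zero>\<^bsub>X\<^esub> \<zero>\<^bsub>X\<^esub> \<oplus>\<^bsub>Y\<^esub> y)"
proof -
  have "s \<zero>\<^bsub>X\<^esub> = inc S (c \<one>\<^bsub>R\<^esub> \<zero>\<^bsub>X\<^esub> \<zero>\<^bsub>X\<^esub>)"
    using factor_systemD(1,3)[OF sc] factor_systemD(4)[OF sc, of "\<one>\<^bsub>R\<^esub>" "\<zero>\<^bsub>X\<^esub>" "\<zero>\<^bsub>X\<^esub>"] by simp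
  then show ?thesis
    using assms factor_systemD(3)[OF sc] by (simp add: inc_add[symmetric] Y.M.r_neg2)
qed

end

end

lemma represents_imp_equiv:
  assumes "left_module R Y" "left_module R X" "short_exact R Y X S" "short_exact R Y X T"
    and "represents R Y X S c" "represents R Y X T c"
  shows "ses_equiv R Y S T"
proof -
  interpret S: short_exact_sequence R Y X S using assms(1-3) by (rule short_exact_sequenceI)
  interpret T: short_exact_sequence R Y X T using assms(1,2,4) by (rule short_exact_sequenceI)
  obtain s where sf: "factor_system R Y X S s c"
    using assms(5) by (auto simp: represents_def)
  obtain t where tf: "factor_system R Y X T t c"
    using assms(6) by (auto simp: represents_def)
  note s = factor_systemD(1,2)[OF sf] and c = factor_systemD(3)[OF sf]
    and t = factor_systemD(1,2)[OF tf]
  define \<alpha> where "\<alpha> = (\<lambda>(x, y). s x \<oplus>\<^bsub>mid S\<^esub> inc S y)"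
  define \<beta> where "\<beta> = (\<lambda>(x, y). t x \<oplus>\<^bsub>mid T\<^esub> inc T y)"
  define A where "A = carrier X \<times> carrier Y"
  have \<alpha>: "bij_betw \<alpha> A (carrier (mid S))" and \<beta>: "bij_betw \<beta> A (carrier (mid T))"
    unfolding \<alpha>_def \<beta>_def A_def using s t by (auto intro!: S.sect_bij T.sect_bij simp: sect_of_def)
  define h where "h = \<beta> \<circ> the_inv_into A \<alpha>"
  have bij: "bij_betw h (carrier (mid S)) (carrier (mid T))"
    unfolding h_def using bij_betw_the_inv_into[OF \<alpha>] \<beta> by (rule bij_betw_trans)
  have h: "h (s x \<oplus>\<^bsub>mid S\<^esub> inc S y) = t x \<oplus>\<^bsub>mid T\<^esub> inc T y"
    if "x \<in> carrier X" "y \<in> carrier Y" for x y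
  proof -
    have "the_inv_into A \<alpha> (\<alpha> (x, y)) = (x, y)"
      using \<alpha> that by (intro the_inv_into_f_f) (auto simp: bij_betw_def A_def)
    then show ?thesis by (simp add: h_def \<alpha>_def \<beta>_def)
  qed
  have decomp: "\<exists>x\<in>carrier X. \<exists>y\<in>carrier Y. e = s x \<oplus>\<^bsub>mid S\<^esub> inc S y"
    if "e \<in> carrier (mid S)" for e
  proof -
    have "e \<in> \<alpha> ` A" using bij_betw_imp_surj_on[OF \<alpha>] that by simp
    then show ?thesis by (auto simp: \<alpha>_def A_def)
  qed
  have hom: "h \<in> mod_hom R (mid S) (mid T)"
  proof (rule mod_homI)
    fix r e e' assume r: "r \<in> carrier R" and "e \<in> carrier (mid S)" "e' \<in> carrier (mid S)"
    then obtain x y x' y' where xy: "x \<in> carrier X" "y \<in> carrier Y" "x' \<in> carrier X" "y' \<in> carrier Y"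
      and e: "e = s x \<oplus>\<^bsub>mid S\<^esub> inc S y" "e' = s x' \<oplus>\<^bsub>mid S\<^esub> inc S y'"
      using decomp by meson
    show "h (r \<odot>\<^bsub>mid S\<^esub> e \<oplus>\<^bsub>mid S\<^esub> e') = r \<odot>\<^bsub>mid T\<^esub> h e \<oplus>\<^bsub>mid T\<^esub> h e'"
      unfolding e S.factor_system_lin[OF sf r xy(1,3,2,4)]
      using r xy c by (simp add: h T.factor_system_lin[OF tf])
  qed (use bij S.E.left_module_axioms T.E.left_module_axioms in \<open>auto simp: bij_betw_def\<close>)
  have "h (inc S y) = inc T y" if y: "y \<in> carrier Y" for y
    unfolding S.factor_system_inc[OF sf y] T.factor_system_inc[OF tf y] using y c by (simp add: h)
  moreover have "prj T (h e) = prj S e" if "e \<in> carrier (mid S)" for e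
    using decomp[OF that] s t by (auto simp: h S.prj_add T.prj_add)
  ultimately show ?thesis using hom bij by (auto simp: ses_equiv_def)
qed

lemma represents_ses_equiv:
  assumes "left_module R X" "left_module R (mid S)" "left_module R (mid T)"
    and "inc T \<in> mod_hom R Y (mid T)"
    and "ses_equiv R Y T S" "represents R Y X S c"
  shows "represents R Y X T c"
proof -
  interpret X: left_module R X by fact
  interpret E: left_module R "mid S" by fact
  interpret F: left_module R "mid T" by fact
  obtain h where h: "h \<in> mod_hom R (mid T) (mid S)" "bij_betw h (carrier (mid T)) (carrier (mid S))"
    "\<And>y. y \<in> carrier Y \<Longrightarrow> h (inc T y) = inc S y"
    "\<And>e. e \<in> carrier (mid T) \<Longrightarrow> prj S (h e) = prj T e"
    using assms(5) by (auto simp: ses_equiv_def)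
  define g where "g = the_inv_into (carrier (mid T)) h"
  have g: "g e \<in> carrier (mid T)" "h (g e) = e" if "e \<in> carrier (mid S)" for e
    using that h(2) bij_betw_the_inv_into[OF h(2)] f_the_inv_into_f_bij_betw[OF h(2)]
    by (auto simp: g_def bij_betw_def)
  have inj: "a = b" if "h a = h b" "a \<in> carrier (mid T)" "b \<in> carrier (mid T)" for a b
    using h(2) that by (auto simp: bij_betw_def inj_on_def)
  obtain s where sf: "factor_system R Y X S s c"
    using assms(6) by (auto simp: represents_def)
  note s = factor_systemD(1,2)[OF sf] and sc = factor_systemD(4)[OF sf] and c = factor_systemD(3)[OF sf]
  show ?thesis
  proof (rule representsI[of _ "\<lambda>x. g (s x)"])
    fix r x x' assume a: "r \<in> carrier R" "x \<in> carrier X" "x' \<in> carrier X"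
    then show "r \<odot>\<^bsub>mid T\<^esub> g (s x) \<oplus>\<^bsub>mid T\<^esub> g (s x')
        = g (s (r \<odot>\<^bsub>X\<^esub> x \<oplus>\<^bsub>X\<^esub> x')) \<oplus>\<^bsub>mid T\<^esub> inc T (c r x x')"
      using s g c sc[OF a] mod_hom_closed[OF assms(4)]
      by (intro inj) (simp_all add: mod_hom_add[OF h(1)] mod_hom_smult[OF h(1)] h(3))
  qed (use s g c in \<open>auto simp: h(4)[symmetric]\<close>)
qed

section \<open>Constructions with short exact sequences\<close>

lemma ses_copy:
  fixes U :: "('r, 'y, 'e, 'x) ses"
  assumes "left_module R Y" "left_module R X" "short_exact R Y X U"
  shows "\<exists>T :: ('r, 'y, 'x \<times> 'y, 'x) ses. short_exact R Y X T \<and> ses_equiv R Y T U"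
proof -
  interpret U: short_exact_sequence R Y X U using assms by (rule short_exact_sequenceI)
  obtain s where s: "sect_of X U s" using U.ex_sect by blast
  define h where "h = (\<lambda>(x, y). s x \<oplus>\<^bsub>mid U\<^esub> inc U y)"
  define A where "A = carrier X \<times> carrier Y"
  define g where "g = the_inv_into A h"
  have h: "bij_betw h A (carrier (mid U))"
    unfolding h_def A_def by (rule U.sect_bij) fact
  have hg: "h (g e) = e" if "e \<in> carrier (mid U)" for e
    unfolding g_def using h that by (rule f_the_inv_into_f_bij_betw)
  have gh: "g (h a) = a" if "a \<in> A" for a
    unfolding g_def using h that by (auto simp: bij_betw_def intro!: the_inv_into_f_f)
  have hA: "h a \<in> carrier (mid U)" if "a \<in> A" for a
    using h that by (auto simp: bij_betw_def)
  have gA: "g e \<in> A" if "e \<in> carrier (mid U)" for e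
    using bij_betw_the_inv_into[OF h] that by (auto simp: g_def bij_betw_def)
  define E :: "('r, 'x \<times> 'y) module" where "E = \<lparr>carrier = A, monoid.mult = undefined, monoid.one = undefined,
     ring.zero = g \<zero>\<^bsub>mid U\<^esub>, ring.add = (\<lambda>a b. g (h a \<oplus>\<^bsub>mid U\<^esub> h b)), smult = (\<lambda>r a. g (r \<odot>\<^bsub>mid U\<^esub> h a))\<rparr>"
  have [simp]: "carrier E = A" "\<zero>\<^bsub>E\<^esub> = g \<zero>\<^bsub>mid U\<^esub>" "\<And>a b. a \<oplus>\<^bsub>E\<^esub> b = g (h a \<oplus>\<^bsub>mid U\<^esub> h b)"
    "\<And>r a. r \<odot>\<^bsub>E\<^esub> a = g (r \<odot>\<^bsub>mid U\<^esub> h a)"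
    by (simp_all add: E_def)
  have g: "g \<in> mod_hom R (mid U) E"
    by (auto simp: mod_hom_def gA hg)
  have "g ` carrier (mid U) = carrier E"
  proof (intro equalityI subsetI)
    fix a assume "a \<in> carrier E"
    then have "h a \<in> carrier (mid U)" "a = g (h a)" by (simp_all add: hA gh)
    then show "a \<in> g ` carrier (mid U)" by blast
  qed (auto simp: gA)
  then have E: "left_module R E"
    using left_module_surj_image[OF U.E.left_module_axioms g] by simp
  have hhom: "h \<in> mod_hom R E (mid U)"
    by (auto simp: mod_hom_def hA hg)
  define T where "T = \<lparr>mid = E, inc = (\<lambda>y. g (inc U y)), prj = (\<lambda>a. prj U (h a))\<rparr>"
  have "ses_equiv R Y T U"
    unfolding ses_equiv_def by (rule bexI[of _ h]) (auto simp: T_def h hg hhom)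
  moreover have "short_exact R Y X T"
  proof (rule short_exactI)
    show "inc T \<in> mod_hom R Y (mid T)" "prj T \<in> mod_hom R (mid T) X"
      using mod_hom_comp[OF U.inc_hom g] mod_hom_comp[OF hhom U.prj_hom] by (simp_all add: T_def)
    show "y = \<zero>\<^bsub>Y\<^esub>" if "y \<in> carrier Y" "inc T y = \<zero>\<^bsub>mid T\<^esub>" for y
    proof -
      have "inc U y = \<zero>\<^bsub>mid U\<^esub>"
      proof -
        have "g (inc U y) = g \<zero>\<^bsub>mid U\<^esub>" using that(2) by (simp add: T_def)
        then show ?thesis using hg that(1) by (metis U.inc_closed U.E.M.zero_closed)
      qed
      then show ?thesis using that U.inc_eq_iff[of y "\<zero>\<^bsub>Y\<^esub>"] by (simp add: U.inc_zero)
    qed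
    show "\<exists>y\<in>carrier Y. e = inc T y" if "e \<in> carrier (mid T)" "prj T e = \<zero>\<^bsub>X\<^esub>" for e
    proof -
      have e: "e \<in> A" "prj U (h e) = \<zero>\<^bsub>X\<^esub>" using that by (simp_all add: T_def)
      obtain y where "y \<in> carrier Y" "h e = inc U y" using U.exactE[OF hA[OF e(1)] e(2)] by blast
      then show ?thesis using gh[OF e(1)] by (auto simp: T_def)
    qed
    show "\<exists>e\<in>carrier (mid T). prj T e = x" if "x \<in> carrier X" for x
    proof -
      obtain e where "e \<in> carrier (mid U)" "prj U e = x"
        using U.prj_image \<open>x \<in> carrier X\<close> by (metis imageE)
      then show ?thesis using gA hg by (intro bexI[of _ "g e"]) (auto simp: T_def)
    qed
  qed (use assms E hg in \<open>auto simp: T_def\<close>)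
  ultimately show ?thesis by blast
qed

lemma ses_pullback_simps [simp]:
  "carrier (mid (ses_pullback X' k S)) =
     {p. fst p \<in> carrier (mid S) \<and> snd p \<in> carrier X' \<and> prj S (fst p) = k (snd p)}"
  "\<zero>\<^bsub>mid (ses_pullback X' k S)\<^esub> = (\<zero>\<^bsub>mid S\<^esub>, \<zero>\<^bsub>X'\<^esub>)"
  "p \<oplus>\<^bsub>mid (ses_pullback X' k S)\<^esub> p' = (fst p \<oplus>\<^bsub>mid S\<^esub> fst p', snd p \<oplus>\<^bsub>X'\<^esub> snd p')"
  "r \<odot>\<^bsub>mid (ses_pullback X' k S)\<^esub> p = (r \<odot>\<^bsub>mid S\<^esub> fst p, r \<odot>\<^bsub>X'\<^esub> snd p)"
  "inc (ses_pullback X' k S) y = (inc S y, \<zero>\<^bsub>X'\<^esub>)"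
  "prj (ses_pullback X' k S) = snd"
  by (auto simp: ses_pullback_def)

context
  fixes R :: "('r, 'q) ring_scheme" and Y :: "('r, 'y) module" and X :: "('r, 'x) module"
    and X' :: "('r, 'x') module" and S :: "('r, 'y, 'e, 'x) ses" and k
  assumes S: "short_exact_sequence R Y X S" and X': "left_module R X'" and k: "k \<in> mod_hom R X' X"
begin

interpretation S: short_exact_sequence R Y X S by (fact S)
interpretation X': left_module R X' by (fact X')

lemma short_exact_pullback: "short_exact R Y X' (ses_pullback X' k S)"
proof -
  interpret P: left_module R "mod_prod (mid S) X'"
    using S.E.left_module_axioms X' by (rule left_module_prod)
  have kz: "k \<zero>\<^bsub>X'\<^esub> = \<zero>\<^bsub>X\<^esub>" using k X' S.X.left_module_axioms by (rule mod_hom_zero)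
  have "submodule {(e, x'). e \<in> carrier (mid S) \<and> x' \<in> carrier X' \<and> prj S e = k x'} R
      (mod_prod (mid S) X')"
    by (rule P.submoduleI)
      (auto simp: S.prj_add S.prj_smult S.prj_zero mod_hom_add[OF k] mod_hom_smult[OF k] kz)
  then have mid: "left_module R (mid (ses_pullback X' k S))"
    unfolding ses_pullback_def using left_module_submodule[OF P.left_module_axioms] by simp
  show ?thesis
  proof (rule short_exactI[OF S.Y.left_module_axioms X' mid])
    show "inc (ses_pullback X' k S) \<in> mod_hom R Y (mid (ses_pullback X' k S))"
      by (auto simp: mod_hom_def kz S.inc_add S.inc_smult)
    show "prj (ses_pullback X' k S) \<in> mod_hom R (mid (ses_pullback X' k S)) X'"
      by (auto simp: mod_hom_def)
    show "y = \<zero>\<^bsub>Y\<^esub>"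
      if "y \<in> carrier Y" "inc (ses_pullback X' k S) y = \<zero>\<^bsub>mid (ses_pullback X' k S)\<^esub>" for y
      using that S.inc_eq_iff[of y "\<zero>\<^bsub>Y\<^esub>"] by (simp add: S.inc_zero)
    show "\<exists>y\<in>carrier Y. e = inc (ses_pullback X' k S) y"
      if "e \<in> carrier (mid (ses_pullback X' k S))" "prj (ses_pullback X' k S) e = \<zero>\<^bsub>X'\<^esub>" for e
    proof -
      have e: "fst e \<in> carrier (mid S)" "prj S (fst e) = \<zero>\<^bsub>X\<^esub>" "snd e = \<zero>\<^bsub>X'\<^esub>"
        using that by (auto simp: kz)
      obtain y where "y \<in> carrier Y" "fst e = inc S y" using S.exactE[OF e(1,2)] by blast
      then show ?thesis using e(3) by (intro bexI[of _ y]) (auto simp: prod_eq_iff)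
    qed
    show "\<exists>e\<in>carrier (mid (ses_pullback X' k S)). prj (ses_pullback X' k S) e = x"
      if "x \<in> carrier X'" for x
    proof -
      obtain e where "e \<in> carrier (mid S)" "prj S e = k x"
        using S.prj_image mod_hom_closed[OF k \<open>x \<in> carrier X'\<close>] by (metis imageE)
      then show ?thesis using that by (intro bexI[of _ "(e, x)"]) auto
    qed
  qed auto
qed

lemma represents_pullback:
  assumes "represents R Y X S c"
  shows "represents R Y X' (ses_pullback X' k S) (\<lambda>r x x'. c r (k x) (k x'))"
proof -
  obtain s where s: "factor_system R Y X S s c"
    using assms by (auto simp: represents_def)
  show ?thesis
    by (rule representsI[of _ "\<lambda>x. (s (k x), x)"])
      (auto simp: factor_systemD[OF s] mod_hom_closed[OF k] mod_hom_add[OF k] mod_hom_smult[OF k])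
qed

end

lemma ses_prod_simps [simp]:
  "mid (ses_prod S T) = mod_prod (mid S) (mid T)"
  "inc (ses_prod S T) p = (inc S (fst p), inc T (snd p))"
  "prj (ses_prod S T) e = (prj S (fst e), prj T (snd e))"
  by (auto simp: ses_prod_def map_prod_def case_prod_beta)

context
  fixes R :: "('r, 'q) ring_scheme" and Y :: "('r, 'y) module" and X :: "('r, 'x) module"
    and Y' :: "('r, 'y') module" and X' :: "('r, 'x') module"
    and S :: "('r, 'y, 'e, 'x) ses" and T :: "('r, 'y', 'f, 'x') ses"
  assumes S: "short_exact_sequence R Y X S" and T: "short_exact_sequence R Y' X' T"
begin

interpretation S: short_exact_sequence R Y X S by (fact S)
interpretation T: short_exact_sequence R Y' X' T by (fact T)

lemma short_exact_prod: "short_exact R (mod_prod Y Y') (mod_prod X X') (ses_prod S T)"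
proof (rule short_exactI)
  show "p = \<zero>\<^bsub>mod_prod Y Y'\<^esub>"
    if "p \<in> carrier (mod_prod Y Y')" "inc (ses_prod S T) p = \<zero>\<^bsub>mid (ses_prod S T)\<^esub>" for p
    using that S.inc_eq_iff[of "fst p" "\<zero>\<^bsub>Y\<^esub>"] T.inc_eq_iff[of "snd p" "\<zero>\<^bsub>Y'\<^esub>"]
    by (auto simp: S.inc_zero T.inc_zero)
  show "\<exists>p\<in>carrier (mod_prod Y Y'). e = inc (ses_prod S T) p"
    if "e \<in> carrier (mid (ses_prod S T))" "prj (ses_prod S T) e = \<zero>\<^bsub>mod_prod X X'\<^esub>" for e
  proof -
    have e: "fst e \<in> carrier (mid S)" "prj S (fst e) = \<zero>\<^bsub>X\<^esub>"
      "snd e \<in> carrier (mid T)" "prj T (snd e) = \<zero>\<^bsub>X'\<^esub>"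
      using that by auto
    obtain y where "y \<in> carrier Y" "fst e = inc S y" using S.exactE[OF e(1,2)] by blast
    moreover obtain y' where "y' \<in> carrier Y'" "snd e = inc T y'" using T.exactE[OF e(3,4)] by blast
    ultimately show ?thesis by (intro bexI[of _ "(y, y')"]) (auto simp: prod_eq_iff)
  qed
  show "\<exists>e\<in>carrier (mid (ses_prod S T)). prj (ses_prod S T) e = x"
    if "x \<in> carrier (mod_prod X X')" for x
  proof -
    have x: "fst x \<in> carrier X" "snd x \<in> carrier X'" using that by auto
    obtain e where "e \<in> carrier (mid S)" "prj S e = fst x" using S.prj_image x by (metis imageE)
    moreover obtain e' where "e' \<in> carrier (mid T)" "prj T e' = snd x"
      using T.prj_image x by (metis imageE)
    ultimately show ?thesis by (intro bexI[of _ "(e, e')"]) (auto simp: prod_eq_iff)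
  qed
qed (use S.Y.left_module_axioms S.X.left_module_axioms S.E.left_module_axioms
    T.Y.left_module_axioms T.X.left_module_axioms T.E.left_module_axioms
    in \<open>auto simp: mod_hom_def S.inc_add S.inc_smult T.inc_add T.inc_smult
      S.prj_add S.prj_smult T.prj_add T.prj_smult intro!: left_module_prod\<close>)

lemma represents_prod:
  assumes "represents R Y X S c" "represents R Y' X' T d"
  shows "represents R (mod_prod Y Y') (mod_prod X X') (ses_prod S T)
    (\<lambda>r p p'. (c r (fst p) (fst p'), d r (snd p) (snd p')))"
proof -
  obtain s t where st: "factor_system R Y X S s c" "factor_system R Y' X' T t d"
    using assms by (auto simp: represents_def)
  show ?thesis
    by (rule representsI[of _ "\<lambda>p. (s (fst p), t (snd p))"])
      (auto simp: factor_systemD[OF st(1)] factor_systemD[OF st(2)])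
qed

end

context
  fixes R :: "('r, 'q) ring_scheme" and Y :: "('r, 'y) module" and X :: "('r, 'x) module"
    and Y' :: "('r, 'y') module" and S :: "('r, 'y, 'e, 'x) ses" and h
  assumes S: "short_exact_sequence R Y X S" and Y': "left_module R Y'" and h: "h \<in> mod_hom R Y Y'"
begin

interpretation S: short_exact_sequence R Y X S by (fact S)
interpretation Y': left_module R Y' by (fact Y')
interpretation P: left_module R "mod_prod Y' (mid S)"
  using Y' S.E.left_module_axioms by (rule left_module_prod)

lemma submodule_pushout_relations: "submodule (pushout_relations Y h S) R (mod_prod Y' (mid S))"
proof (rule P.submoduleI)
  fix a b assume "a \<in> pushout_relations Y h S" "b \<in> pushout_relations Y h S"
  then obtain y z where yz: "y \<in> carrier Y" "z \<in> carrier Y"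
    "a = (h y, \<ominus>\<^bsub>mid S\<^esub> inc S y)" "b = (h z, \<ominus>\<^bsub>mid S\<^esub> inc S z)"
    by (auto simp: pushout_relations_def)
  then have "a \<oplus>\<^bsub>mod_prod Y' (mid S)\<^esub> b = (h (y \<oplus>\<^bsub>Y\<^esub> z), \<ominus>\<^bsub>mid S\<^esub> inc S (y \<oplus>\<^bsub>Y\<^esub> z))"
    by (simp add: mod_hom_add[OF h] S.inc_add S.E.M.minus_add)
  then show "a \<oplus>\<^bsub>mod_prod Y' (mid S)\<^esub> b \<in> pushout_relations Y h S"
    using yz by (auto simp: pushout_relations_def)
next
  fix r a assume r: "r \<in> carrier R" and "a \<in> pushout_relations Y h S"
  then obtain y where y: "y \<in> carrier Y" "a = (h y, \<ominus>\<^bsub>mid S\<^esub> inc S y)"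
    by (auto simp: pushout_relations_def)
  then have "r \<odot>\<^bsub>mod_prod Y' (mid S)\<^esub> a = (h (r \<odot>\<^bsub>Y\<^esub> y), \<ominus>\<^bsub>mid S\<^esub> inc S (r \<odot>\<^bsub>Y\<^esub> y))"
    using r by (simp add: mod_hom_smult[OF h] S.inc_smult S.E.smult_minus)
  then show "r \<odot>\<^bsub>mod_prod Y' (mid S)\<^esub> a \<in> pushout_relations Y h S"
    using y r by (auto simp: pushout_relations_def)
next
  have "\<zero>\<^bsub>mod_prod Y' (mid S)\<^esub> = (h \<zero>\<^bsub>Y\<^esub>, \<ominus>\<^bsub>mid S\<^esub> inc S \<zero>\<^bsub>Y\<^esub>)"
    by (simp add: mod_hom_zero[OF h S.Y.left_module_axioms Y'] S.inc_zero)
  then show "\<zero>\<^bsub>mod_prod Y' (mid S)\<^esub> \<in> pushout_relations Y h S"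
    by (auto simp: pushout_relations_def)
qed (auto simp: pushout_relations_def mod_hom_closed[OF h])

definition pushout_map :: "'y' \<times> 'e \<Rightarrow> ('y' \<times> 'e) set" where
  "pushout_map p = pushout_relations Y h S +>\<^bsub>mod_prod Y' (mid S)\<^esub> p"

lemma pushout_map_hom: "pushout_map \<in> mod_hom R (mod_prod Y' (mid S)) (mid (ses_pushout Y Y' h S))"
  using quot_map_hom[OF P.left_module_axioms submodule_pushout_relations]
  by (simp add: ses_pushout_def pushout_map_def[abs_def])

lemma pushout_map_surj:
  "pushout_map ` (carrier Y' \<times> carrier (mid S)) = carrier (mid (ses_pushout Y Y' h S))"
  using quot_map_surj[OF P.left_module_axioms submodule_pushout_relations]
  by (simp add: ses_pushout_def pushout_map_def[abs_def])

lemma left_module_pushout: "left_module R (mid (ses_pushout Y Y' h S))"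
  using left_module_quot[OF P.left_module_axioms submodule_pushout_relations]
  by (simp add: ses_pushout_def)

lemma pushout_map_eq_iff:
  assumes "y \<in> carrier Y'" "e \<in> carrier (mid S)" "y' \<in> carrier Y'" "e' \<in> carrier (mid S)"
  shows "pushout_map (y, e) = pushout_map (y', e') \<longleftrightarrow>
    (\<exists>z\<in>carrier Y. y \<ominus>\<^bsub>Y'\<^esub> y' = h z \<and> e \<ominus>\<^bsub>mid S\<^esub> e' = \<ominus>\<^bsub>mid S\<^esub> inc S z)"
proof -
  have "(y, e) \<ominus>\<^bsub>mod_prod Y' (mid S)\<^esub> (y', e') = (y \<ominus>\<^bsub>Y'\<^esub> y', e \<ominus>\<^bsub>mid S\<^esub> e')"
    using assms mod_prod_minus[OF Y' S.E.left_module_axioms, of "(y', e')"]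
    by (simp add: P.M.minus_eq Y'.M.minus_eq S.E.M.minus_eq)
  then show ?thesis
    unfolding pushout_map_def using assms
    by (subst quot_map_eq_iff[OF P.left_module_axioms submodule_pushout_relations])
      (auto simp: pushout_relations_def)
qed

lemma pushout_map_comm:
  assumes "y \<in> carrier Y"
  shows "pushout_map (\<zero>\<^bsub>Y'\<^esub>, inc S y) = pushout_map (h y, \<zero>\<^bsub>mid S\<^esub>)"
  using assms mod_hom_closed[OF h]
  by (subst pushout_map_eq_iff)
    (auto intro!: bexI[of _ "\<ominus>\<^bsub>Y\<^esub> y"] simp: mod_hom_minus[OF h S.Y.left_module_axioms Y']
      Y'.M.minus_eq S.inc_minus S.E.M.minus_eq S.inc_zero S.E.M.minus_equality)

lemma pushout_inc: "inc (ses_pushout Y Y' h S) y = pushout_map (y, \<zero>\<^bsub>mid S\<^esub>)"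
  by (simp add: ses_pushout_def pushout_map_def)

lemma pushout_prj:
  assumes "y \<in> carrier Y'" "e \<in> carrier (mid S)"
  shows "prj (ses_pushout Y Y' h S) (pushout_map (y, e)) = prj S e"
proof -
  have const: "(\<lambda>(y', e). prj S e) p = prj S e" if p: "p \<in> pushout_map (y, e)" for p
  proof -
    obtain z where "z \<in> carrier Y" "p = (h z \<oplus>\<^bsub>Y'\<^esub> y, (\<ominus>\<^bsub>mid S\<^esub> inc S z) \<oplus>\<^bsub>mid S\<^esub> e)"
      using p by (auto simp: pushout_map_def a_r_coset_def' pushout_relations_def)
    then show ?thesis using assms by (simp add: S.prj_add S.prj_minus)
  qed
  have "(h \<zero>\<^bsub>Y\<^esub>, \<ominus>\<^bsub>mid S\<^esub> inc S \<zero>\<^bsub>Y\<^esub>) \<oplus>\<^bsub>mod_prod Y' (mid S)\<^esub> (y, e) \<in> pushout_map (y, e)"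
    unfolding pushout_map_def a_r_coset_def' pushout_relations_def by blast
  then have "pushout_map (y, e) \<noteq> {}" by blast
  then have "(\<lambda>(y', e). prj S e) ` pushout_map (y, e) = {prj S e}"
    using image_cong[OF refl const, of "pushout_map (y, e)"] by (simp add: image_constant_conv)
  then show ?thesis by (simp add: ses_pushout_def)
qed

lemma short_exact_pushout: "short_exact R Y' X (ses_pushout Y Y' h S)"
proof (rule short_exactI[OF Y' S.X.left_module_axioms left_module_pushout])
  let ?P = "ses_pushout Y Y' h S"
  interpret M: left_module R "mid ?P" by (rule left_module_pushout)
  note q = mod_hom_add[OF pushout_map_hom, symmetric] mod_hom_smult[OF pushout_map_hom, symmetric]
    mod_hom_closed[OF pushout_map_hom]
  have ex: "\<exists>y\<in>carrier Y'. \<exists>e\<in>carrier (mid S). a = pushout_map (y, e)" if "a \<in> carrier (mid ?P)" for a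
    using that unfolding pushout_map_surj[symmetric] by auto
  show "inc ?P \<in> mod_hom R Y' (mid ?P)"
    by (auto simp: mod_hom_def pushout_inc q)
  show "prj ?P \<in> mod_hom R (mid ?P) X"
  proof (rule mod_homI)
    fix r a b assume r: "r \<in> carrier R" and "a \<in> carrier (mid ?P)" "b \<in> carrier (mid ?P)"
    then obtain y e y' e' where "y \<in> carrier Y'" "e \<in> carrier (mid S)" "a = pushout_map (y, e)"
      "y' \<in> carrier Y'" "e' \<in> carrier (mid S)" "b = pushout_map (y', e')"
      using ex by meson
    then show "prj ?P (r \<odot>\<^bsub>mid ?P\<^esub> a \<oplus>\<^bsub>mid ?P\<^esub> b) = r \<odot>\<^bsub>X\<^esub> prj ?P a \<oplus>\<^bsub>X\<^esub> prj ?P b"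
      using r by (simp add: q pushout_prj S.prj_add S.prj_smult)
  next
    fix a assume "a \<in> carrier (mid ?P)"
    then obtain y e where "y \<in> carrier Y'" "e \<in> carrier (mid S)" "a = pushout_map (y, e)"
      using ex by meson
    then show "prj ?P a \<in> carrier X" by (simp add: pushout_prj)
  qed (rule left_module_pushout S.X.left_module_axioms)+
  show "y = \<zero>\<^bsub>Y'\<^esub>" if y: "y \<in> carrier Y'" and eq: "inc ?P y = \<zero>\<^bsub>mid ?P\<^esub>" for y
  proof -
    have "pushout_map (y, \<zero>\<^bsub>mid S\<^esub>) = pushout_map (\<zero>\<^bsub>Y'\<^esub>, \<zero>\<^bsub>mid S\<^esub>)"
      using eq mod_hom_zero[OF pushout_map_hom P.left_module_axioms left_module_pushout]
      by (simp add: pushout_inc)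
    then obtain z where z: "z \<in> carrier Y" and hz: "y \<ominus>\<^bsub>Y'\<^esub> \<zero>\<^bsub>Y'\<^esub> = h z"
      and iz: "\<zero>\<^bsub>mid S\<^esub> \<ominus>\<^bsub>mid S\<^esub> \<zero>\<^bsub>mid S\<^esub> = \<ominus>\<^bsub>mid S\<^esub> inc S z"
      unfolding pushout_map_eq_iff[OF y S.E.M.zero_closed Y'.M.zero_closed S.E.M.zero_closed] by blast
    have "\<ominus>\<^bsub>mid S\<^esub> inc S z = \<zero>\<^bsub>mid S\<^esub>"
      unfolding iz[symmetric] by (simp add: S.E.diff_eq_zero_iff)
    then have "inc S z = inc S \<zero>\<^bsub>Y\<^esub>"
      using z S.E.M.l_neg[of "inc S z"] by (simp add: S.inc_zero)
    then have "h z = \<zero>\<^bsub>Y'\<^esub>"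
      using z by (simp add: S.inc_eq_iff mod_hom_zero[OF h S.Y.left_module_axioms Y'])
    then show ?thesis using hz y by (simp add: Y'.diff_eq_zero_iff)
  qed
  show "\<exists>y\<in>carrier Y'. a = inc ?P y" if a: "a \<in> carrier (mid ?P)" "prj ?P a = \<zero>\<^bsub>X\<^esub>" for a
  proof -
    obtain y e where ye: "y \<in> carrier Y'" "e \<in> carrier (mid S)" "a = pushout_map (y, e)"
      using ex[OF a(1)] by blast
    then have "prj S e = \<zero>\<^bsub>X\<^esub>" using a by (simp add: pushout_prj)
    then obtain z where z: "z \<in> carrier Y" "e = inc S z" using S.exactE ye by blast
    have "a = pushout_map (y, \<zero>\<^bsub>mid S\<^esub>) \<oplus>\<^bsub>mid ?P\<^esub> pushout_map (\<zero>\<^bsub>Y'\<^esub>, inc S z)"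
      using ye z by (simp add: q)
    also have "\<dots> = pushout_map (y \<oplus>\<^bsub>Y'\<^esub> h z, \<zero>\<^bsub>mid S\<^esub>)"
      using ye z mod_hom_closed[OF h] by (simp add: pushout_map_comm q)
    finally show ?thesis
      using ye z mod_hom_closed[OF h] by (intro bexI[of _ "y \<oplus>\<^bsub>Y'\<^esub> h z"]) (auto simp: pushout_inc)
  qed
  show "\<exists>a\<in>carrier (mid ?P). prj ?P a = x" if x: "x \<in> carrier X" for x
  proof -
    obtain e where "e \<in> carrier (mid S)" "prj S e = x" using S.prj_image x by (metis imageE)
    then show ?thesis by (intro bexI[of _ "pushout_map (\<zero>\<^bsub>Y'\<^esub>, e)"]) (auto simp: pushout_prj q)
  qed
qed (auto simp: pushout_inc pushout_prj S.prj_zero)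

lemma represents_pushout:
  assumes "represents R Y X S c"
  shows "represents R Y' X (ses_pushout Y Y' h S) (\<lambda>r x x'. h (c r x x'))"
proof -
  obtain s where s: "factor_system R Y X S s c"
    using assms by (auto simp: represents_def)
  note q = mod_hom_add[OF pushout_map_hom, symmetric] mod_hom_smult[OF pushout_map_hom, symmetric]
    mod_hom_closed[OF pushout_map_hom]
  show ?thesis
  proof (rule representsI[of _ "\<lambda>x. pushout_map (\<zero>\<^bsub>Y'\<^esub>, s x)"])
    fix r x x' assume a: "r \<in> carrier R" "x \<in> carrier X" "x' \<in> carrier X"
    then show "r \<odot>\<^bsub>mid (ses_pushout Y Y' h S)\<^esub> pushout_map (\<zero>\<^bsub>Y'\<^esub>, s x)
        \<oplus>\<^bsub>mid (ses_pushout Y Y' h S)\<^esub> pushout_map (\<zero>\<^bsub>Y'\<^esub>, s x')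
      = pushout_map (\<zero>\<^bsub>Y'\<^esub>, s (r \<odot>\<^bsub>X\<^esub> x \<oplus>\<^bsub>X\<^esub> x'))
        \<oplus>\<^bsub>mid (ses_pushout Y Y' h S)\<^esub> inc (ses_pushout Y Y' h S) (h (c r x x'))"
      using pushout_map_comm[of "c r x x'", symmetric] factor_systemD[OF s]
      by (simp add: q pushout_inc)
  qed (auto simp: q pushout_prj factor_systemD[OF s] mod_hom_closed[OF h])
qed

end

lemma split_ses_simps [simp]:
  "mid (split_ses Y X) = mod_prod X Y" "inc (split_ses Y X) y = (\<zero>\<^bsub>X\<^esub>, y)" "prj (split_ses Y X) = fst"
  by (simp_all add: split_ses_def)

lemma short_exact_split:
  assumes "left_module R Y" "left_module R X"
  shows "short_exact R Y X (split_ses Y X)"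
proof -
  interpret Y: left_module R Y by fact
  interpret X: left_module R X by fact
  show ?thesis
    by (rule short_exactI) (auto simp: assms left_module_prod mod_hom_def)
qed

lemma ses_direct_sum_simps [simp]:
  "mid (ses_direct_sum I S) = direct_sum I (\<lambda>i. mid (S i))"
  "inc (ses_direct_sum I S) v = (\<lambda>i\<in>I. inc (S i) (v i))"
  "prj (ses_direct_sum I S) e = (\<lambda>i\<in>I. prj (S i) (e i))"
  by (simp_all add: ses_direct_sum_def)

lemma direct_sum_map_closed:
  assumes M: "\<And>i. i \<in> I \<Longrightarrow> left_module R (M i)" and N: "\<And>i. i \<in> I \<Longrightarrow> left_module R (N i)"
    and h: "\<And>i. i \<in> I \<Longrightarrow> h i \<in> mod_hom R (M i) (N i)" and v: "v \<in> carrier (direct_sum I M)"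
  shows "(\<lambda>i\<in>I. h i (v i)) \<in> carrier (direct_sum I N)"
  by (rule direct_sumI[where F = "{i \<in> I. v i \<noteq> \<zero>\<^bsub>M i\<^esub>}"])
    (auto simp: direct_sum_finite[OF v] mod_hom_closed[OF h] direct_sum_closed[OF v]
      mod_hom_zero[OF h M N])

lemma short_exact_direct_sum:
  fixes R :: "('r, 'q) ring_scheme" and Y :: "'i \<Rightarrow> ('r, 'y) module" and X :: "'i \<Rightarrow> ('r, 'x) module"
    and S :: "'i \<Rightarrow> ('r, 'y, 'e, 'x) ses"
  assumes R: "ring R" and S: "\<And>i. i \<in> I \<Longrightarrow> short_exact_sequence R (Y i) (X i) (S i)"
  shows "short_exact R (direct_sum I Y) (direct_sum I X) (ses_direct_sum I S)"
proof -
  let ?S = "ses_direct_sum I S"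
  have Y: "left_module R (Y i)" and X: "left_module R (X i)" and E: "left_module R (mid (S i))"
    and inc: "inc (S i) \<in> mod_hom R (Y i) (mid (S i))" and prj: "prj (S i) \<in> mod_hom R (mid (S i)) (X i)"
    if "i \<in> I" for i
    using short_exact_sequence.inc_hom[OF S[OF that]] short_exact_sequence.prj_hom[OF S[OF that]]
      S[OF that, unfolded short_exact_sequence_def] by blast+
  have DY: "left_module R (direct_sum I Y)" and DX: "left_module R (direct_sum I X)"
    and DE: "left_module R (mid ?S)"
    using Y X E by (simp_all add: left_module_direct_sum[OF R])
  have incD: "inc ?S v \<in> carrier (mid ?S)" if "v \<in> carrier (direct_sum I Y)" for v
    using direct_sum_map_closed[where h = "\<lambda>i. inc (S i)" and R = R, OF Y E inc that] by simp
  have prjD: "prj ?S v \<in> carrier (direct_sum I X)" if "v \<in> carrier (mid ?S)" for v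
    using direct_sum_map_closed[where h = "\<lambda>i. prj (S i)" and R = R and M = "\<lambda>i. mid (S i)", OF E X prj] that
    by simp
  show ?thesis
  proof (rule short_exactI[OF DY DX DE])
    show "inc ?S \<in> mod_hom R (direct_sum I Y) (mid ?S)"
      using incD by (auto simp: mod_hom_def direct_sum_closed mod_hom_add[OF inc] mod_hom_smult[OF inc]
          intro!: restrict_ext)
    show "prj ?S \<in> mod_hom R (mid ?S) (direct_sum I X)"
      using prjD by (auto simp: mod_hom_def direct_sum_closed[where M = "\<lambda>i. mid (S i)"] mod_hom_add[OF prj] mod_hom_smult[OF prj]
          intro!: restrict_ext)
    show "v = \<zero>\<^bsub>direct_sum I Y\<^esub>" if v: "v \<in> carrier (direct_sum I Y)" "inc ?S v = \<zero>\<^bsub>mid ?S\<^esub>" for v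
    proof (rule extensionalityI[OF direct_sum_extensional[OF v(1)]])
      fix i assume i: "i \<in> I"
      interpret S: short_exact_sequence R "Y i" "X i" "S i" using S i .
      have "inc (S i) (v i) = inc (S i) \<zero>\<^bsub>Y i\<^esub>"
        using fun_cong[OF v(2), of i] i by (simp add: S.inc_zero)
      then show "v i = \<zero>\<^bsub>direct_sum I Y\<^esub> i"
        using i direct_sum_closed[OF v(1)] by (simp add: S.inc_eq_iff)
    qed simp
    show "prj ?S (inc ?S v) = \<zero>\<^bsub>direct_sum I X\<^esub>" if "v \<in> carrier (direct_sum I Y)" for v
      using that by (auto simp: direct_sum_closed short_exact_sequence.prj_inc[OF S] intro!: restrict_ext)
    show "\<exists>v\<in>carrier (direct_sum I Y). e = inc ?S v"
      if e: "e \<in> carrier (mid ?S)" "prj ?S e = \<zero>\<^bsub>direct_sum I X\<^esub>" for e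
    proof -
      have e': "e \<in> carrier (direct_sum I (\<lambda>i. mid (S i)))" using e by simp
      have "\<exists>y. y \<in> carrier (Y i) \<and> e i = inc (S i) y" if i: "i \<in> I" for i
      proof -
        have "prj (S i) (e i) = \<zero>\<^bsub>X i\<^esub>" using fun_cong[OF e(2), of i] i by simp
        then show ?thesis
          using short_exact_sequence.exactE[OF S[OF i] direct_sum_closed[OF e' i]] by blast
      qed
      then obtain v where v: "\<And>i. i \<in> I \<Longrightarrow> v i \<in> carrier (Y i) \<and> e i = inc (S i) (v i)"
        by metis
      have "v i = \<zero>\<^bsub>Y i\<^esub>" if i: "i \<in> I" "e i = \<zero>\<^bsub>mid (S i)\<^esub>" for i
      proof -
        interpret S: short_exact_sequence R "Y i" "X i" "S i" using S i(1) .
        show ?thesis using v[OF i(1)] i S.inc_eq_iff[of "v i" "\<zero>\<^bsub>Y i\<^esub>"] by (simp add: S.inc_zero)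
      qed
      then have "restrict v I \<in> carrier (direct_sum I Y)"
        by (intro direct_sumI[where F = "{i \<in> I. e i \<noteq> \<zero>\<^bsub>mid (S i)\<^esub>}"])
          (use v direct_sum_finite[OF e'] in auto)
      moreover have "e = inc ?S (restrict v I)"
        by (rule extensionalityI[OF direct_sum_extensional[OF e']]) (use v in auto)
      ultimately show ?thesis by blast
    qed
    show "\<exists>e\<in>carrier (mid ?S). prj ?S e = x" if x: "x \<in> carrier (direct_sum I X)" for x
    proof -
      have "\<exists>e. e \<in> carrier (mid (S i)) \<and> prj (S i) e = x i \<and> (x i = \<zero>\<^bsub>X i\<^esub> \<longrightarrow> e = \<zero>\<^bsub>mid (S i)\<^esub>)"
        if i: "i \<in> I" for i
      proof (cases "x i = \<zero>\<^bsub>X i\<^esub>")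
        case True
        interpret S: short_exact_sequence R "Y i" "X i" "S i" using S i .
        show ?thesis using True S.prj_zero by auto
      next
        case False
        then show ?thesis
          using short_exact_sequence.prj_image[OF S[OF i]] direct_sum_closed[OF x i] by (metis imageE)
      qed
      then obtain e where e: "\<And>i. i \<in> I \<Longrightarrow>
          e i \<in> carrier (mid (S i)) \<and> prj (S i) (e i) = x i \<and> (x i = \<zero>\<^bsub>X i\<^esub> \<longrightarrow> e i = \<zero>\<^bsub>mid (S i)\<^esub>)"
        by metis
      have "restrict e I \<in> carrier (mid ?S)"
        unfolding ses_direct_sum_simps
        by (rule direct_sumI[where F = "{i \<in> I. x i \<noteq> \<zero>\<^bsub>X i\<^esub>}"]) (use e direct_sum_finite[OF x] in auto)
      moreover have "prj ?S (restrict e I) = x"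
        by (rule sym, rule extensionalityI[OF direct_sum_extensional[OF x]]) (use e in auto)
      ultimately show ?thesis by blast
    qed
  qed
qed

section \<open>\<open>Ext\<close> in terms of factor systems\<close>

lemma (in left_module) finsum_smult:
  assumes "finite A" "f \<in> A \<rightarrow> carrier M" "r \<in> carrier R"
  shows "r \<odot>\<^bsub>M\<^esub> finsum M f A = finsum M (\<lambda>i. r \<odot>\<^bsub>M\<^esub> f i) A"
  using assms(1,2)
proof (induction A)
  case empty
  then show ?case using assms(3) by simp
next
  case (insert a A)
  then have f: "f \<in> A \<rightarrow> carrier M" "f a \<in> carrier M" by auto
  then have "(\<lambda>i. r \<odot>\<^bsub>M\<^esub> f i) \<in> A \<rightarrow> carrier M" using assms(3) by auto
  then show ?case
    using insert.hyps insert.IH f assms(3) by (simp add: M.finsum_insert smult_r_distr)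
qed

context
  fixes R :: "('r, 'q) ring_scheme" and M :: "('r, 'a) module"
  assumes M: "left_module R M"
begin

interpretation left_module R M by (fact M)

lemma summation_map_eq_finsum:
  assumes "v \<in> carrier (direct_sum I (\<lambda>_. M))" "finite A" "A \<subseteq> I"
    and "\<And>i. i \<in> I \<Longrightarrow> i \<notin> A \<Longrightarrow> v i = \<zero>\<^bsub>M\<^esub>"
  shows "summation_map I M v = finsum M v A"
  unfolding summation_map_def
  using assms direct_sum_closed[OF assms(1)]
  by (intro M.add.finprod_mono_neutral_cong_left) auto

lemma summation_map_hom: "summation_map I M \<in> mod_hom R (direct_sum I (\<lambda>_. M)) M"
proof -
  have D: "left_module R (direct_sum I (\<lambda>_. M))"
    using R.ring_axioms left_module_axioms by (rule left_module_direct_sum)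
  show ?thesis
  proof (rule mod_homI[OF D])
    show "summation_map I M v \<in> carrier M" if "v \<in> carrier (direct_sum I (\<lambda>_. M))" for v
      unfolding summation_map_def using direct_sum_closed[OF that] by (intro M.finsum_closed) auto
    fix r v w assume r: "r \<in> carrier R"
      and v: "v \<in> carrier (direct_sum I (\<lambda>_. M))" and w: "w \<in> carrier (direct_sum I (\<lambda>_. M))"
    let ?D = "direct_sum I (\<lambda>_. M)"
    let ?A = "{i \<in> I. v i \<noteq> \<zero>\<^bsub>M\<^esub>} \<union> {i \<in> I. w i \<noteq> \<zero>\<^bsub>M\<^esub>}"
    interpret D: left_module R ?D by (rule D)
    have A: "finite ?A" "?A \<subseteq> I" using direct_sum_finite[OF v] direct_sum_finite[OF w] by auto
    have vA: "v \<in> ?A \<rightarrow> carrier M" "w \<in> ?A \<rightarrow> carrier M"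
      using direct_sum_closed[OF v] direct_sum_closed[OF w] by auto
    have rv: "(\<lambda>i. r \<odot>\<^bsub>M\<^esub> v i) \<in> ?A \<rightarrow> carrier M" using vA r by auto
    have "summation_map I M (r \<odot>\<^bsub>?D\<^esub> v \<oplus>\<^bsub>?D\<^esub> w) = finsum M (r \<odot>\<^bsub>?D\<^esub> v \<oplus>\<^bsub>?D\<^esub> w) ?A"
      using r v w A by (intro summation_map_eq_finsum D.M.a_closed D.smult_closed) auto
    also have "\<dots> = finsum M (\<lambda>i. r \<odot>\<^bsub>M\<^esub> v i \<oplus>\<^bsub>M\<^esub> w i) ?A"
      using vA rv by (intro M.finsum_cong') auto
    also have "\<dots> = r \<odot>\<^bsub>M\<^esub> finsum M v ?A \<oplus>\<^bsub>M\<^esub> finsum M w ?A"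
      using A vA rv r by (simp only: M.finsum_addf finsum_smult)
    also have "\<dots> = r \<odot>\<^bsub>M\<^esub> summation_map I M v \<oplus>\<^bsub>M\<^esub> summation_map I M w"
      using summation_map_eq_finsum[OF v A] summation_map_eq_finsum[OF w A] by auto
    finally show "summation_map I M (r \<odot>\<^bsub>?D\<^esub> v \<oplus>\<^bsub>?D\<^esub> w)
        = r \<odot>\<^bsub>M\<^esub> summation_map I M v \<oplus>\<^bsub>M\<^esub> summation_map I M w" .
  qed (rule left_module_axioms)
qed

end

definition factor_sets ::
  "('r, 'q) ring_scheme \<Rightarrow> ('r, 'y) module \<Rightarrow> ('r, 'x) module \<Rightarrow> ('r \<Rightarrow> 'x \<Rightarrow> 'x \<Rightarrow> 'y) set" where
  "factor_sets R Y X =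
     {c. \<exists>S :: ('r, 'y, 'x \<times> 'y, 'x) ses. short_exact R Y X S \<and> represents R Y X S c}"

definition ext_of ::
  "('r, 'q) ring_scheme \<Rightarrow> ('r, 'y) module \<Rightarrow> ('r, 'x) module \<Rightarrow> ('r \<Rightarrow> 'x \<Rightarrow> 'x \<Rightarrow> 'y)
    \<Rightarrow> ('r, 'y, 'x \<times> 'y, 'x) ses set" where
  "ext_of R Y X c = {T. short_exact R Y X T \<and> represents R Y X T c}"

context
  fixes R :: "('r, 'q) ring_scheme" and Y :: "('r, 'y) module" and X :: "('r, 'x) module"
  assumes Y: "left_module R Y" and X: "left_module R X"
begin

interpretation Y: left_module R Y by (fact Y)
interpretation X: left_module R X by (fact X)

lemma ext_class_eq_ext_of:
  assumes "short_exact R Y X S" "represents R Y X S c"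
  shows "ext_class R Y X S = ext_of R Y X c"
proof -
  have "represents R Y X T c" if "short_exact R Y X T" "ses_equiv R Y T S"
    for T :: "('r, 'y, 'x \<times> 'y, 'x) ses"
    using that assms by (intro represents_ses_equiv[OF X, of S T]) (auto simp: short_exact_def)
  moreover have "ses_equiv R Y T S" if "short_exact R Y X T" "represents R Y X T c"
    for T :: "('r, 'y, 'x \<times> 'y, 'x) ses"
    using represents_imp_equiv[OF Y X that(1) assms(1) that(2) assms(2)] .
  ultimately show ?thesis unfolding ext_class_def ext_of_def by blast
qed

lemma factor_setsI:
  fixes U :: "('r, 'y, 'e, 'x) ses"
  assumes "short_exact R Y X U" "represents R Y X U c"
  shows "c \<in> factor_sets R Y X"
proof -
  obtain T :: "('r, 'y, 'x \<times> 'y, 'x) ses" where T: "short_exact R Y X T" "ses_equiv R Y T U"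
    using ses_copy[OF Y X assms(1)] by blast
  then have "represents R Y X T c"
    using assms by (intro represents_ses_equiv[OF X, of U T]) (auto simp: short_exact_def)
  then show ?thesis using T unfolding factor_sets_def by blast
qed

lemma factor_setsE:
  assumes "c \<in> factor_sets R Y X"
  obtains S :: "('r, 'y, 'x \<times> 'y, 'x) ses" where "short_exact R Y X S" "represents R Y X S c"
    "ext_of R Y X c = ext_class R Y X S"
  using assms ext_class_eq_ext_of by (auto simp: factor_sets_def)

lemma factor_sets_closed:
  assumes "c \<in> factor_sets R Y X" "r \<in> carrier R" "x \<in> carrier X" "x' \<in> carrier X"
  shows "c r x x' \<in> carrier Y"
  using assms represents_closed by (fastforce simp: factor_sets_def)

lemma ext_of_cong:
  assumes "\<And>r x x'. \<lbrakk>r \<in> carrier R; x \<in> carrier X; x' \<in> carrier X\<rbrakk> \<Longrightarrow> d r x x' = c r x x'"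
  shows "ext_of R Y X d = ext_of R Y X c"
proof -
  have "represents R Y X T d \<longleftrightarrow> represents R Y X T c" for T :: "('r, 'y, 'x \<times> 'y, 'x) ses"
    using represents_cong[of R Y X T c d] represents_cong[of R Y X T d c] assms by auto
  then show ?thesis by (simp add: ext_of_def)
qed

lemma Ext1_carrier: "carrier (Ext1 R X Y) = ext_of R Y X ` factor_sets R Y X"
proof -
  have "\<exists>c\<in>factor_sets R Y X. ext_class R Y X S = ext_of R Y X c"
    if "short_exact R Y X S" for S :: "('r, 'y, 'x \<times> 'y, 'x) ses"
  proof -
    obtain c where c: "represents R Y X S c"
      using short_exact_sequence.ex_represents[OF short_exact_sequenceI[OF Y X \<open>short_exact R Y X S\<close>]]
      by blast
    then show ?thesis
      using ext_class_eq_ext_of[OF \<open>short_exact R Y X S\<close> c] factor_setsI[OF \<open>short_exact R Y X S\<close> c]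
      by blast
  qed
  moreover have "\<exists>S :: ('r, 'y, 'x \<times> 'y, 'x) ses. short_exact R Y X S \<and> ext_of R Y X c = ext_class R Y X S"
    if "c \<in> factor_sets R Y X" for c
    by (rule factor_setsE[OF that]) blast
  ultimately show ?thesis unfolding Ext1_def by fastforce
qed

lemma UN_ext_of:
  assumes "c \<in> factor_sets R Y X"
    and "\<And>S. short_exact R Y X S \<Longrightarrow> represents R Y X S c \<Longrightarrow> F S = A"
  shows "(\<Union>S\<in>ext_of R Y X c. F S) = A"
proof -
  have "ext_of R Y X c \<noteq> {}" using assms(1) by (auto simp: ext_of_def factor_sets_def)
  moreover have "F S = A" if "S \<in> ext_of R Y X c" for S using that assms(2) by (auto simp: ext_of_def)
  ultimately show ?thesis by auto
qed

lemma baer_sum_represents: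
  assumes S: "short_exact R Y X S" and T: "short_exact R Y X T"
    and c: "represents R Y X S c" and d: "represents R Y X T d"
  shows "short_exact R Y X (baer_sum Y X S T)"
    and "represents R Y X (baer_sum Y X S T) (\<lambda>r x x'. c r x x' \<oplus>\<^bsub>Y\<^esub> d r x x')"
proof -
  note P = short_exact_sequenceI[OF left_module_prod[OF Y Y] left_module_prod[OF X X]
      short_exact_prod[OF short_exact_sequenceI[OF Y X S] short_exact_sequenceI[OF Y X T]]]
  have diag: "(\<lambda>x. (x, x)) \<in> mod_hom R X (mod_prod X X)"
    by (auto simp: mod_hom_def)
  have add: "(\<lambda>(y, y'). y \<oplus>\<^bsub>Y\<^esub> y') \<in> mod_hom R (mod_prod Y Y) Y"
    by (auto simp: mod_hom_def Y.smult_r_distr Y.M.a_ac)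
  note Q = short_exact_sequenceI[OF left_module_prod[OF Y Y] X short_exact_pullback[OF P X diag]]
  show "short_exact R Y X (baer_sum Y X S T)"
    unfolding baer_sum_def by (rule short_exact_pushout[OF Q Y add])
  show "represents R Y X (baer_sum Y X S T) (\<lambda>r x x'. c r x x' \<oplus>\<^bsub>Y\<^esub> d r x x')"
    using represents_pushout[OF Q Y add represents_pullback[OF P X diag
          represents_prod[OF short_exact_sequenceI[OF Y X S] short_exact_sequenceI[OF Y X T] c d]]]
    unfolding baer_sum_def by simp
qed

lemma Ext1_add:
  assumes c: "c \<in> factor_sets R Y X" and d: "d \<in> factor_sets R Y X"
  shows "(\<lambda>r x x'. c r x x' \<oplus>\<^bsub>Y\<^esub> d r x x') \<in> factor_sets R Y X"
    and "ext_of R Y X c \<oplus>\<^bsub>Ext1 R X Y\<^esub> ext_of R Y X d = ext_of R Y X (\<lambda>r x x'. c r x x' \<oplus>\<^bsub>Y\<^esub> d r x x')"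
proof -
  show "(\<lambda>r x x'. c r x x' \<oplus>\<^bsub>Y\<^esub> d r x x') \<in> factor_sets R Y X"
    by (rule factor_setsE[OF c], rule factor_setsE[OF d], rule factor_setsI[OF baer_sum_represents])
  show "ext_of R Y X c \<oplus>\<^bsub>Ext1 R X Y\<^esub> ext_of R Y X d = ext_of R Y X (\<lambda>r x x'. c r x x' \<oplus>\<^bsub>Y\<^esub> d r x x')"
    unfolding Ext1_def ring.simps
    by (intro UN_ext_of c d ext_class_eq_ext_of baer_sum_represents)
qed

lemma represents_split_zero: "represents R Y X (split_ses Y X) (\<lambda>r x x'. \<zero>\<^bsub>Y\<^esub>)"
  by (rule representsI[of _ "\<lambda>x. (x, \<zero>\<^bsub>Y\<^esub>)"]) auto

lemma Ext1_zero:
  shows "(\<lambda>r x x'. \<zero>\<^bsub>Y\<^esub>) \<in> factor_sets R Y X"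
    and "\<zero>\<^bsub>Ext1 R X Y\<^esub> = ext_of R Y X (\<lambda>r x x'. \<zero>\<^bsub>Y\<^esub>)"
  using factor_setsI[OF short_exact_split[OF Y X] represents_split_zero]
    ext_class_eq_ext_of[OF short_exact_split[OF Y X] represents_split_zero]
  by (simp_all add: Ext1_def)

lemma Ext1_smult:
  assumes c: "c \<in> factor_sets R Y X" and \<phi>: "\<phi> \<in> mod_hom R X X"
  shows "(\<lambda>r x x'. c r (\<phi> x) (\<phi> x')) \<in> factor_sets R Y X"
    and "\<phi> \<odot>\<^bsub>Ext1 R X Y\<^esub> ext_of R Y X c = ext_of R Y X (\<lambda>r x x'. c r (\<phi> x) (\<phi> x'))"
proof -
  have *: "short_exact R Y X (ses_pullback X \<phi> S)"
    "represents R Y X (ses_pullback X \<phi> S) (\<lambda>r x x'. c r (\<phi> x) (\<phi> x'))"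
    if "short_exact R Y X S" "represents R Y X S c" for S :: "('r, 'y, 'x \<times> 'y, 'x) ses"
    using short_exact_pullback[OF short_exact_sequenceI[OF Y X that(1)] X \<phi>]
      represents_pullback[OF short_exact_sequenceI[OF Y X that(1)] X \<phi> that(2)] by auto
  show "(\<lambda>r x x'. c r (\<phi> x) (\<phi> x')) \<in> factor_sets R Y X"
    by (rule factor_setsE[OF c], rule factor_setsI[OF *])
  show "\<phi> \<odot>\<^bsub>Ext1 R X Y\<^esub> ext_of R Y X c = ext_of R Y X (\<lambda>r x x'. c r (\<phi> x) (\<phi> x'))"
    unfolding Ext1_def module.simps by (intro UN_ext_of c ext_class_eq_ext_of *)
qed

lemma abelian_monoid_Ext1: "abelian_monoid (Ext1 R X Y)"
proof (rule abelian_monoidI)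
  show "\<zero>\<^bsub>Ext1 R X Y\<^esub> \<in> carrier (Ext1 R X Y)" by (simp add: Ext1_carrier Ext1_zero)
next
  fix C D assume "C \<in> carrier (Ext1 R X Y)" "D \<in> carrier (Ext1 R X Y)"
  then obtain c d where cd: "c \<in> factor_sets R Y X" "d \<in> factor_sets R Y X"
    "C = ext_of R Y X c" "D = ext_of R Y X d"
    by (auto simp: Ext1_carrier)
  then show "C \<oplus>\<^bsub>Ext1 R X Y\<^esub> D \<in> carrier (Ext1 R X Y)" by (simp add: Ext1_carrier Ext1_add)
  show "C \<oplus>\<^bsub>Ext1 R X Y\<^esub> D = D \<oplus>\<^bsub>Ext1 R X Y\<^esub> C"
    unfolding cd(3,4) Ext1_add(2)[OF cd(1,2)] Ext1_add(2)[OF cd(2,1)]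
    by (rule ext_of_cong) (simp add: factor_sets_closed[OF cd(1)] factor_sets_closed[OF cd(2)] Y.M.a_comm)
next
  fix C D E assume "C \<in> carrier (Ext1 R X Y)" "D \<in> carrier (Ext1 R X Y)" "E \<in> carrier (Ext1 R X Y)"
  then obtain c d e where
    cde: "c \<in> factor_sets R Y X" "d \<in> factor_sets R Y X" "e \<in> factor_sets R Y X"
    and eqs: "C = ext_of R Y X c" "D = ext_of R Y X d" "E = ext_of R Y X e"
    by (auto simp: Ext1_carrier)
  show "C \<oplus>\<^bsub>Ext1 R X Y\<^esub> D \<oplus>\<^bsub>Ext1 R X Y\<^esub> E = C \<oplus>\<^bsub>Ext1 R X Y\<^esub> (D \<oplus>\<^bsub>Ext1 R X Y\<^esub> E)"
    unfolding eqs Ext1_add(2)[OF cde(1,2)] Ext1_add(2)[OF Ext1_add(1)[OF cde(1,2)] cde(3)]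
      Ext1_add(2)[OF cde(2,3)] Ext1_add(2)[OF cde(1) Ext1_add(1)[OF cde(2,3)]]
    by (rule ext_of_cong) (simp add: cde[THEN factor_sets_closed] Y.M.a_assoc)
next
  fix C assume "C \<in> carrier (Ext1 R X Y)"
  then obtain c where c: "c \<in> factor_sets R Y X" and eq: "C = ext_of R Y X c"
    by (auto simp: Ext1_carrier)
  show "\<zero>\<^bsub>Ext1 R X Y\<^esub> \<oplus>\<^bsub>Ext1 R X Y\<^esub> C = C"
    unfolding eq Ext1_zero(2) Ext1_add(2)[OF Ext1_zero(1) c]
    by (rule ext_of_cong) (simp add: factor_sets_closed[OF c])
qed

lemma Ext1_finsum:
  assumes "finite F" "\<And>i. i \<in> F \<Longrightarrow> c i \<in> factor_sets R Y X"
  shows "(\<lambda>r x x'. \<Oplus>\<^bsub>Y\<^esub>i\<in>F. c i r x x') \<in> factor_sets R Y X \<and>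
    (\<Oplus>\<^bsub>Ext1 R X Y\<^esub>i\<in>F. ext_of R Y X (c i)) = ext_of R Y X (\<lambda>r x x'. \<Oplus>\<^bsub>Y\<^esub>i\<in>F. c i r x x')"
  using assms
proof (induction F)
  case empty
  interpret E: abelian_monoid "Ext1 R X Y" by (rule abelian_monoid_Ext1)
  show ?case by (simp add: Ext1_zero)
next
  case (insert a F)
  interpret E: abelian_monoid "Ext1 R X Y" by (rule abelian_monoid_Ext1)
  let ?s = "\<lambda>r x x'. \<Oplus>\<^bsub>Y\<^esub>i\<in>F. c i r x x'"
  have eq: "(\<Oplus>\<^bsub>Y\<^esub>i\<in>insert a F. c i r x x') = c a r x x' \<oplus>\<^bsub>Y\<^esub> ?s r x x'"
    if "r \<in> carrier R" "x \<in> carrier X" "x' \<in> carrier X" for r x x'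
    using insert.hyps insert.prems that by (intro Y.M.finsum_insert) (auto intro: factor_sets_closed)
  have s: "?s \<in> factor_sets R Y X" and a: "c a \<in> factor_sets R Y X"
    using insert.IH insert.prems by auto
  have "(\<Oplus>\<^bsub>Ext1 R X Y\<^esub>i\<in>insert a F. ext_of R Y X (c i)) = ext_of R Y X (c a) \<oplus>\<^bsub>Ext1 R X Y\<^esub> ext_of R Y X ?s"
    using insert by (subst E.finsum_insert) (auto simp: Ext1_carrier)
  also have "\<dots> = ext_of R Y X (\<lambda>r x x'. c a r x x' \<oplus>\<^bsub>Y\<^esub> ?s r x x')"
    by (rule Ext1_add(2)[OF a s])
  finally have "(\<Oplus>\<^bsub>Ext1 R X Y\<^esub>i\<in>insert a F. ext_of R Y X (c i)) = \<dots>" .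
  moreover have "ext_of R Y X (\<lambda>r x x'. c a r x x' \<oplus>\<^bsub>Y\<^esub> ?s r x x')
      = ext_of R Y X (\<lambda>r x x'. \<Oplus>\<^bsub>Y\<^esub>i\<in>insert a F. c i r x x')"
    by (rule ext_of_cong) (simp add: eq)
  moreover have "(\<lambda>r x x'. \<Oplus>\<^bsub>Y\<^esub>i\<in>insert a F. c i r x x') \<in> factor_sets R Y X"
  proof -
    obtain S :: "('r, 'y, 'x \<times> 'y, 'x) ses" where S: "short_exact R Y X S"
      "represents R Y X S (\<lambda>r x x'. c a r x x' \<oplus>\<^bsub>Y\<^esub> ?s r x x')"
      using Ext1_add(1)[OF a s] by (rule factor_setsE)
    show ?thesis by (rule factor_setsI[OF S(1) represents_cong[OF S(2)]]) (simp add: eq)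
  qed
  ultimately show ?case by simp
qed

end

lemma represents_direct_sum:
  fixes R :: "('r, 'q) ring_scheme" and Y :: "'i \<Rightarrow> ('r, 'y) module" and X :: "'i \<Rightarrow> ('r, 'x) module"
    and S :: "'i \<Rightarrow> ('r, 'y, 'e, 'x) ses"
  assumes R: "ring R" and S: "\<And>i. i \<in> I \<Longrightarrow> short_exact_sequence R (Y i) (X i) (S i)"
    and c: "\<And>i. i \<in> I \<Longrightarrow> represents R (Y i) (X i) (S i) (c i)"
    and c0: "\<And>i r. i \<in> I \<Longrightarrow> r \<in> carrier R \<Longrightarrow> c i r \<zero>\<^bsub>X i\<^esub> \<zero>\<^bsub>X i\<^esub> = \<zero>\<^bsub>Y i\<^esub>"
  shows "represents R (direct_sum I Y) (direct_sum I X) (ses_direct_sum I S)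
    (\<lambda>r v w. \<lambda>i\<in>I. c i r (v i) (w i))"
proof -
  obtain s where s: "\<And>i. i \<in> I \<Longrightarrow> factor_system R (Y i) (X i) (S i) (s i) (c i)"
    using c unfolding represents_def by metis
  have s0: "s i \<zero>\<^bsub>X i\<^esub> = \<zero>\<^bsub>mid (S i)\<^esub>" if i: "i \<in> I" for i
  proof -
    interpret S: short_exact_sequence R "Y i" "X i" "S i" using S i .
    show ?thesis
      using factor_systemD(1)[OF s[OF i]] factor_systemD(4)[OF s[OF i], of "\<one>\<^bsub>R\<^esub>" "\<zero>\<^bsub>X i\<^esub>" "\<zero>\<^bsub>X i\<^esub>"] c0[OF i]
      by (simp add: S.inc_zero)
  qed
  show ?thesis
  proof (rule representsI[of _ "\<lambda>v. \<lambda>i\<in>I. s i (v i)"])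
    fix v assume v: "v \<in> carrier (direct_sum I X)"
    show "(\<lambda>i\<in>I. s i (v i)) \<in> carrier (mid (ses_direct_sum I S))"
      unfolding ses_direct_sum_simps
      by (rule direct_sumI[where F = "{i \<in> I. v i \<noteq> \<zero>\<^bsub>X i\<^esub>}"])
        (auto simp: direct_sum_finite[OF v] direct_sum_closed[OF v] factor_systemD(1)[OF s] s0)
    show "prj (ses_direct_sum I S) (\<lambda>i\<in>I. s i (v i)) = v"
      by (rule sym, rule extensionalityI[OF direct_sum_extensional[OF v]])
        (auto simp: direct_sum_closed[OF v] factor_systemD(2)[OF s])
  next
    fix r v w assume r: "r \<in> carrier R" and v: "v \<in> carrier (direct_sum I X)"
      and w: "w \<in> carrier (direct_sum I X)"
    show "(\<lambda>i\<in>I. c i r (v i) (w i)) \<in> carrier (direct_sum I Y)"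
      by (rule direct_sumI[where F = "{i \<in> I. v i \<noteq> \<zero>\<^bsub>X i\<^esub>} \<union> {i \<in> I. w i \<noteq> \<zero>\<^bsub>X i\<^esub>}"])
        (auto simp: r direct_sum_finite[OF v] direct_sum_finite[OF w] direct_sum_closed[OF v]
          direct_sum_closed[OF w] factor_systemD(3)[OF s] c0)
    show "r \<odot>\<^bsub>mid (ses_direct_sum I S)\<^esub> (\<lambda>i\<in>I. s i (v i)) \<oplus>\<^bsub>mid (ses_direct_sum I S)\<^esub> (\<lambda>i\<in>I. s i (w i))
        = (\<lambda>i\<in>I. s i ((r \<odot>\<^bsub>direct_sum I X\<^esub> v \<oplus>\<^bsub>direct_sum I X\<^esub> w) i))
          \<oplus>\<^bsub>mid (ses_direct_sum I S)\<^esub> inc (ses_direct_sum I S) (\<lambda>i\<in>I. c i r (v i) (w i))"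
      by (auto simp: r direct_sum_closed[OF v] direct_sum_closed[OF w] factor_systemD(4)[OF s]
          intro!: restrict_ext)
  qed
qed

section \<open>Homomorphisms into the middle term of a universal sequence\<close>

lemma End_ring_simps [simp]:
  "carrier (End_ring R X) = mod_hom R X X \<inter> extensional (carrier X)"
  "\<zero>\<^bsub>End_ring R X\<^esub> = (\<lambda>x\<in>carrier X. \<zero>\<^bsub>X\<^esub>)"
  "\<one>\<^bsub>End_ring R X\<^esub> = (\<lambda>x\<in>carrier X. x)"
  "\<phi> \<otimes>\<^bsub>End_ring R X\<^esub> \<psi> = (\<lambda>x\<in>carrier X. \<psi> (\<phi> x))"
  by (auto simp: End_ring_def)

lemma self_module_simps [simp]:
  "carrier (self_module R) = carrier R" "\<zero>\<^bsub>self_module R\<^esub> = \<zero>\<^bsub>R\<^esub>"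
  "a \<oplus>\<^bsub>self_module R\<^esub> b = a \<oplus>\<^bsub>R\<^esub> b" "r \<odot>\<^bsub>self_module R\<^esub> a = r \<otimes>\<^bsub>R\<^esub> a"
  by (auto simp: self_module_def)

lemma brick_nontrivial:
  assumes "brick R X"
  shows "\<exists>x\<in>carrier X. x \<noteq> \<zero>\<^bsub>X\<^esub>"
proof (rule ccontr)
  assume "\<not> (\<exists>x\<in>carrier X. x \<noteq> \<zero>\<^bsub>X\<^esub>)"
  then have "\<one>\<^bsub>End_ring R X\<^esub> = \<zero>\<^bsub>End_ring R X\<^esub>" by (auto intro!: restrict_ext)
  moreover interpret skew_field "End_ring R X" using assms by (simp add: brick_def)
  have "\<one>\<^bsub>End_ring R X\<^esub> \<in> Units (End_ring R X)" by (rule Units_one_closed)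
  ultimately show False using skew_field_Units by blast
qed

lemma brick_endo_inj:
  assumes "brick R X" "\<phi> \<in> carrier (End_ring R X)" "\<phi> \<noteq> \<zero>\<^bsub>End_ring R X\<^esub>"
    and x: "x \<in> carrier X" "\<phi> x = \<zero>\<^bsub>X\<^esub>"
  shows "x = \<zero>\<^bsub>X\<^esub>"
proof -
  interpret skew_field "End_ring R X" using assms by (simp add: brick_def)
  have X: "left_module R X" using assms by (simp add: brick_def)
  have "\<phi> \<in> Units (End_ring R X)" unfolding skew_field_Units using assms by blast
  then obtain \<psi> where \<psi>: "\<psi> \<in> carrier (End_ring R X)"
    "\<phi> \<otimes>\<^bsub>End_ring R X\<^esub> \<psi> = \<one>\<^bsub>End_ring R X\<^esub>"
    unfolding Units_def by blast
  have "\<psi> (\<phi> x) = x" using fun_cong[OF \<psi>(2), of x] x(1) by simp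
  moreover have "\<psi> \<zero>\<^bsub>X\<^esub> = \<zero>\<^bsub>X\<^esub>" using \<psi>(1) X mod_hom_zero[of \<psi> R X X] by simp
  ultimately show ?thesis using x(2) by simp
qed

text \<open>The components of the composite \<open>X \<rightarrow> M \<rightarrow> \<Oplus> X\<close> are endomorphisms \<open>\<phi>\<^sub>b\<close> of \<open>X\<close>, almost all zero.
  The pull-back of the universal sequence along it has class \<open>\<Sum> \<phi>\<^sub>b [b]\<close>, but splits since it lifts to
  \<open>M\<close>. Linear independence gives \<open>\<phi>\<^sub>b = 0\<close>.\<close>

lemma universal_mono_hom_image:
  fixes R :: "('r, 'q) ring_scheme" and \<X> :: "('r, 'x) module set"
    and Y :: "('r, 'y) module" and M :: "('r, 'm) module"
  assumes R: "ring R" and sb: "semibrick R \<X>" and Y: "left_module R Y"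
    and um: "universal_mono R \<X> Y M j" and XX: "X \<in> \<X>" and f: "f \<in> mod_hom R X M"
  shows "f ` carrier X \<subseteq> j ` carrier Y"
proof -
  obtain B g where B: "\<And>X. X \<in> \<X> \<Longrightarrow> ext_basis R X Y (B X)"
    and se: "short_exact R Y (direct_sum (Sigma \<X> B) fst) \<lparr>mid = M, inc = j, prj = g\<rparr>"
    and eq: "ses_equiv R Y \<lparr>mid = M, inc = j, prj = g\<rparr> (universal_pushout \<X> Y B)"
    using um unfolding universal_mono_def by blast
  define I where "I = Sigma \<X> B"
  define P where "P = universal_pushout \<X> Y B"
  have P_def': "P = ses_pushout (direct_sum I (\<lambda>_. Y)) Y (summation_map I Y) (ses_direct_sum I snd)"
    by (simp add: P_def universal_pushout_def I_def)
  have brick: "brick R X'" if "X' \<in> \<X>" for X' using sb that by (simp add: semibrick_def)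
  have LX: "left_module R X'" if "X' \<in> \<X>" for X' using brick[OF that] by (simp add: brick_def)
  note X = LX[OF XX]
  interpret Y: left_module R Y by (fact Y)
  interpret X: left_module R X by (fact X)
  have S: "short_exact_sequence R Y (fst i) (snd i)" if "i \<in> I" for i
    using that B LX Y by (intro short_exact_sequenceI) (auto simp: I_def ext_basis_def)
  have DX: "left_module R (direct_sum I fst)" and DY: "left_module R (direct_sum I (\<lambda>_. Y))"
    using LX Y by (auto simp: I_def intro!: left_module_direct_sum[OF R])
  note D = short_exact_sequenceI[OF DY DX short_exact_direct_sum[OF R S]]
  note sm = summation_map_hom[OF Y, of I]
  note Pse = short_exact_sequenceI[OF Y DX short_exact_pushout[OF D Y sm], folded P_def']
  interpret P: short_exact_sequence R Y "direct_sum I fst" P by (rule Pse)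
  obtain h where h: "h \<in> mod_hom R M (mid P)" "\<And>e. e \<in> carrier M \<Longrightarrow> prj P (h e) = g e"
    using eq unfolding ses_equiv_def P_def by auto
  have g: "g \<in> mod_hom R M (direct_sum I fst)"
    using se by (simp add: short_exact_def I_def)
  define k where "k = (\<lambda>x. g (f x))"
  have k: "k \<in> mod_hom R X (direct_sum I fst)"
    unfolding k_def using f g by (rule mod_hom_comp)
  have hf: "(\<lambda>x. h (f x)) \<in> mod_hom R X (mid P)" using f h(1) by (rule mod_hom_comp)
  have k_comp: "(\<lambda>x. k x i) \<in> mod_hom R X (fst i)" if "i \<in> I" for i
    using that k by (auto simp: mod_hom_def Pi_iff direct_sum_closed)
  note Q = short_exact_pullback[OF Pse X k]
  have split: "represents R Y X (ses_pullback X k P) (\<lambda>r x x'. \<zero>\<^bsub>Y\<^esub>)"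
    by (rule representsI[of _ "\<lambda>x. (h (f x), x)"])
      (auto simp: mod_hom_closed[OF hf] h(2) mod_hom_closed[OF f] k_def P.inc_zero
        mod_hom_add[OF hf] mod_hom_smult[OF hf])
  have "\<exists>c. represents R Y (fst i) (snd i) c \<and>
      (\<forall>r\<in>carrier R. c r \<zero>\<^bsub>fst i\<^esub> \<zero>\<^bsub>fst i\<^esub> = \<zero>\<^bsub>Y\<^esub>)" if "i \<in> I" for i
    using short_exact_sequence.ex_represents[OF S[OF that]] .
  then obtain c where c: "\<And>i. i \<in> I \<Longrightarrow> represents R Y (fst i) (snd i) (c i)"
    and c0: "\<And>i r. i \<in> I \<Longrightarrow> r \<in> carrier R \<Longrightarrow> c i r \<zero>\<^bsub>fst i\<^esub> \<zero>\<^bsub>fst i\<^esub> = \<zero>\<^bsub>Y\<^esub>"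
    by metis
  define v where "v = (\<lambda>r x x'. \<lambda>i\<in>I. c i r (k x i) (k x' i))"
  note rD = represents_direct_sum[where S = snd and I = I, OF R S c c0]
  have v: "v r x x' \<in> carrier (direct_sum I (\<lambda>_. Y))"
    if "r \<in> carrier R" "x \<in> carrier X" "x' \<in> carrier X" for r x x'
    using represents_closed[OF rD that(1) mod_hom_closed[OF k] mod_hom_closed[OF k]] that
    by (simp add: v_def)
  have rQ: "represents R Y X (ses_pullback X k P) (\<lambda>r x x'. summation_map I Y (v r x x'))"
    using represents_pullback[OF Pse X k represents_pushout[OF D Y sm rD, folded P_def']]
    by (simp add: v_def)
  have zero: "ext_of R Y X (\<lambda>r x x'. summation_map I Y (v r x x')) = \<zero>\<^bsub>Ext1 R X Y\<^esub>"
    using ext_class_eq_ext_of[OF Y X Q rQ] ext_class_eq_ext_of[OF Y X Q split] Ext1_zero(2)[OF Y X]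
    by simp
  define \<phi> where "\<phi> = (\<lambda>b. \<lambda>x\<in>carrier X. k x (X, b))"
  have \<phi>: "\<phi> b \<in> carrier (End_ring R X)" if "b \<in> B X" for b
    using mod_hom_cong[OF X k_comp[of "(X, b)"], of "\<phi> b"] that XX by (auto simp: \<phi>_def I_def)
  define F where "F = {b \<in> B X. \<phi> b \<noteq> \<zero>\<^bsub>End_ring R X\<^esub>}"
  have F: "finite F"
  proof -
    obtain x where x: "x \<in> carrier X" "x \<noteq> \<zero>\<^bsub>X\<^esub>" using brick_nontrivial[OF brick[OF XX]] by blast
    have "k x (X, b) \<noteq> \<zero>\<^bsub>X\<^esub>" if "b \<in> F" for b
      using brick_endo_inj[OF brick[OF XX] \<phi>, of b x] that x by (auto simp: F_def \<phi>_def)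
    then have "Pair X ` F \<subseteq> {i \<in> I. k x i \<noteq> \<zero>\<^bsub>fst i\<^esub>}" using XX by (auto simp: I_def F_def)
    then have "finite (Pair X ` F)"
      using direct_sum_finite[OF mod_hom_closed[OF k x(1)]] by (rule finite_subset)
    then show ?thesis by (rule finite_imageD) (simp add: inj_on_def)
  qed
  have k_zero: "k x i = \<zero>\<^bsub>fst i\<^esub>" if x: "x \<in> carrier X" and i: "i \<in> I" "i \<notin> Pair X ` F" for x i
  proof (cases "fst i = X")
    case True
    then have b: "snd i \<in> B X" "i = (X, snd i)" using i by (auto simp: I_def)
    then have "snd i \<notin> F" using i(2) by (metis imageI)
    then have "\<phi> (snd i) = \<zero>\<^bsub>End_ring R X\<^esub>" using b(1) by (simp add: F_def)
    then show ?thesis using fun_cong[of "\<phi> (snd i)" _ x] x b(2) True by (metis End_ring_simps(2) \<phi>_def restrict_apply')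
  next
    case False
    then have "\<forall>h\<in>mod_hom R X (fst i). \<forall>x\<in>carrier X. h x = \<zero>\<^bsub>fst i\<^esub>"
      using sb XX i(1) unfolding semibrick_def by (auto simp: I_def)
    from bspec[OF bspec[OF this k_comp[OF i(1)]] x] show ?thesis .
  qed
  have cF: "c (X, b) \<in> factor_sets R Y X" "ext_class R Y X b = ext_of R Y X (c (X, b))" if "b \<in> B X" for b
  proof -
    have "(X, b) \<in> I" using that XX by (simp add: I_def)
    then have b: "short_exact R Y X b" "represents R Y X b (c (X, b))"
      using c[of "(X, b)"] S[of "(X, b)"] by (auto simp: short_exact_sequence.short_exact)
    show "c (X, b) \<in> factor_sets R Y X" using factor_setsI[OF Y X b] .
    show "ext_class R Y X b = ext_of R Y X (c (X, b))" using ext_class_eq_ext_of[OF Y X b] .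
  qed
  define d where "d = (\<lambda>b r x x'. c (X, b) r (\<phi> b x) (\<phi> b x'))"
  have d: "d b \<in> factor_sets R Y X" "\<phi> b \<odot>\<^bsub>Ext1 R X Y\<^esub> ext_class R Y X b = ext_of R Y X (d b)"
    if "b \<in> B X" for b
    using Ext1_smult[OF Y X cF(1)[OF that], of "\<phi> b"] \<phi>[OF that] cF(2)[OF that]
    by (auto simp: d_def)
  have sum: "summation_map I Y (v r x x') = (\<Oplus>\<^bsub>Y\<^esub>b\<in>F. d b r x x')"
    if a: "r \<in> carrier R" "x \<in> carrier X" "x' \<in> carrier X" for r x x'
  proof -
    have FI: "Pair X ` F \<subseteq> I" using XX by (auto simp: F_def I_def)
    have "summation_map I Y (v r x x') = finsum Y (v r x x') (Pair X ` F)"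
      using F FI a by (intro summation_map_eq_finsum[OF Y v]) (auto simp: v_def k_zero c0)
    also have "\<dots> = (\<Oplus>\<^bsub>Y\<^esub>b\<in>F. v r x x' (X, b))"
      using direct_sum_closed[OF v[OF a]] FI by (intro Y.M.finsum_reindex) (auto simp: inj_on_def)
    also have "\<dots> = (\<Oplus>\<^bsub>Y\<^esub>b\<in>F. d b r x x')"
    proof (rule Y.M.finsum_cong'[OF refl])
      show "(\<lambda>b. d b r x x') \<in> F \<rightarrow> carrier Y"
        using d(1) factor_sets_closed[OF Y X] a by (auto simp: F_def)
      show "v r x x' (X, b) = d b r x x'" if "b \<in> F" for b
        using that FI a by (auto simp: v_def d_def \<phi>_def)
    qed
    finally show ?thesis .
  qed
  define a where "a = (\<lambda>b\<in>B X. \<phi> b)"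
  have a: "a \<in> carrier (direct_sum (B X) (\<lambda>_. self_module (End_ring R X)))"
    by (rule direct_sumI[OF _ _ F]) (use \<phi> in \<open>auto simp: a_def F_def\<close>)
  interpret E: abelian_monoid "Ext1 R X Y" by (rule abelian_monoid_Ext1[OF Y X])
  have supp: "{b \<in> B X. a b \<noteq> \<zero>\<^bsub>End_ring R X\<^esub>} = F" by (auto simp: a_def F_def)
  have "lin_comb (End_ring R X) (Ext1 R X Y) (B X) (ext_class R Y X) a
      = (\<Oplus>\<^bsub>Ext1 R X Y\<^esub>b\<in>F. a b \<odot>\<^bsub>Ext1 R X Y\<^esub> ext_class R Y X b)"
    unfolding lin_comb_def supp ..
  also have "\<dots> = (\<Oplus>\<^bsub>Ext1 R X Y\<^esub>b\<in>F. ext_of R Y X (d b))"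
    by (rule E.finsum_cong'[OF refl]) (use d in \<open>auto simp: F_def a_def Ext1_carrier[OF Y X]\<close>)
  also have "\<dots> = ext_of R Y X (\<lambda>r x x'. \<Oplus>\<^bsub>Y\<^esub>b\<in>F. d b r x x')"
    using Ext1_finsum[OF Y X F, of d] d(1) by (auto simp: F_def)
  also have "\<dots> = ext_of R Y X (\<lambda>r x x'. summation_map I Y (v r x x'))"
    by (rule ext_of_cong[OF Y X]) (simp add: sum)
  finally have "lin_comb (End_ring R X) (Ext1 R X Y) (B X) (ext_class R Y X) a = \<zero>\<^bsub>Ext1 R X Y\<^esub>"
    using zero by simp
  then have "\<forall>b\<in>B X. a b = \<zero>\<^bsub>End_ring R X\<^esub>"
    using B[OF XX] a unfolding ext_basis_def is_basis_def by blast
  then have "F = {}" by (auto simp: F_def a_def)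
  then have "g (f x) = \<zero>\<^bsub>direct_sum I fst\<^esub>" if x: "x \<in> carrier X" for x
    using k_zero[OF x] direct_sum_extensional[OF mod_hom_closed[OF k x]]
    by (intro extensionalityI[of _ I]) (auto simp: k_def)
  then have "f x \<in> a_kernel M (direct_sum I fst) g" if "x \<in> carrier X" for x
    using that mod_hom_closed[OF f] by (simp add: a_kernel_iff)
  then show ?thesis using se by (auto simp: short_exact_def I_def)
qed

section \<open>The direct limit\<close>

lemma (in ring) left_module_self: "left_module R (self_module R)"
proof (rule left_moduleI[OF ring_axioms])
  show "abelian_group (self_module R)"
    by (rule abelian_groupI) (auto simp: a_ac intro: l_neg bexI[of _ "\<ominus> _"])
qed (auto simp: l_distr r_distr m_assoc)

lemma ds_inj_hom:
  assumes R: "ring R" and M: "\<And>i. i \<in> I \<Longrightarrow> left_module R (M i)" and n: "n \<in> I"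
  shows "ds_inj I M n \<in> mod_hom R (M n) (direct_sum I M)"
proof (rule mod_homI)
  have zero: "\<zero>\<^bsub>M i\<^esub> \<in> carrier (M i)" "\<zero>\<^bsub>M i\<^esub> \<oplus>\<^bsub>M i\<^esub> \<zero>\<^bsub>M i\<^esub> = \<zero>\<^bsub>M i\<^esub>"
    and smult: "r \<in> carrier R \<Longrightarrow> r \<odot>\<^bsub>M i\<^esub> \<zero>\<^bsub>M i\<^esub> = \<zero>\<^bsub>M i\<^esub>" if "i \<in> I" for i r
  proof -
    interpret left_module R "M i" using M[OF that] .
    show "\<zero>\<^bsub>M i\<^esub> \<in> carrier (M i)" "\<zero>\<^bsub>M i\<^esub> \<oplus>\<^bsub>M i\<^esub> \<zero>\<^bsub>M i\<^esub> = \<zero>\<^bsub>M i\<^esub>"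
      "r \<in> carrier R \<Longrightarrow> r \<odot>\<^bsub>M i\<^esub> \<zero>\<^bsub>M i\<^esub> = \<zero>\<^bsub>M i\<^esub>" by simp_all
  qed
  show "ds_inj I M n x \<in> carrier (direct_sum I M)" if "x \<in> carrier (M n)" for x
    unfolding ds_inj_def using that by (intro direct_sumI[where F = "{n}"]) (auto simp: zero)
  show "ds_inj I M n (r \<odot>\<^bsub>M n\<^esub> x \<oplus>\<^bsub>M n\<^esub> y)
      = r \<odot>\<^bsub>direct_sum I M\<^esub> ds_inj I M n x \<oplus>\<^bsub>direct_sum I M\<^esub> ds_inj I M n y"
    if "r \<in> carrier R" "x \<in> carrier (M n)" "y \<in> carrier (M n)" for r x y
    using that by (auto simp: ds_inj_def zero smult intro!: restrict_ext)
qed (use assms left_module_direct_sum in auto)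

text \<open>The submodule of relations is only given as a hull; it is bounded from above by the families that
  \<open>collapse\<close> sends to zero at all late stages.\<close>

primrec collapse ::
  "(nat \<Rightarrow> ('r, 'm) module) \<Rightarrow> (nat \<Rightarrow> 'm \<Rightarrow> 'm) \<Rightarrow> nat \<Rightarrow> (nat \<Rightarrow> 'm) \<Rightarrow> 'm" where
  "collapse T j 0 v = v 0"
| "collapse T j (Suc m) v = j m (collapse T j m v) \<oplus>\<^bsub>T (Suc m)\<^esub> v (Suc m)"

context
  fixes R :: "('r, 'q) ring_scheme" and T :: "nat \<Rightarrow> ('r, 'm) module" and j :: "nat \<Rightarrow> 'm \<Rightarrow> 'm"
  assumes R: "ring R" and T: "\<And>n. left_module R (T n)"
    and j: "\<And>n. j n \<in> mod_hom R (T n) (T (Suc n))" and j_inj: "\<And>n. inj_on (j n) (carrier (T n))"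
begin

abbreviation (input) "DS \<equiv> direct_sum UNIV T"

lemma left_module_DS: "left_module R DS"
  using R T by (rule left_module_direct_sum)

interpretation DS: left_module R DS by (rule left_module_DS)

lemma T_zero [simp]: "\<zero>\<^bsub>T n\<^esub> \<in> carrier (T n)"
  and T_add_zero [simp]: "x \<in> carrier (T n) \<Longrightarrow> x \<oplus>\<^bsub>T n\<^esub> \<zero>\<^bsub>T n\<^esub> = x"
  and T_zero_add [simp]: "x \<in> carrier (T n) \<Longrightarrow> \<zero>\<^bsub>T n\<^esub> \<oplus>\<^bsub>T n\<^esub> x = x"
  and T_add [simp]: "x \<in> carrier (T n) \<Longrightarrow> y \<in> carrier (T n) \<Longrightarrow> x \<oplus>\<^bsub>T n\<^esub> y \<in> carrier (T n)"
proof -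
  interpret left_module R "T n" by (rule T)
  show "\<zero>\<^bsub>T n\<^esub> \<in> carrier (T n)" "x \<in> carrier (T n) \<Longrightarrow> x \<oplus>\<^bsub>T n\<^esub> \<zero>\<^bsub>T n\<^esub> = x"
    "x \<in> carrier (T n) \<Longrightarrow> \<zero>\<^bsub>T n\<^esub> \<oplus>\<^bsub>T n\<^esub> x = x"
    "x \<in> carrier (T n) \<Longrightarrow> y \<in> carrier (T n) \<Longrightarrow> x \<oplus>\<^bsub>T n\<^esub> y \<in> carrier (T n)"
    by simp_all
qed

lemma j_zero [simp]: "j n \<zero>\<^bsub>T n\<^esub> = \<zero>\<^bsub>T (Suc n)\<^esub>"
  using j T T by (rule mod_hom_zero)

lemma inj_hom: "ds_inj UNIV T n \<in> mod_hom R (T n) DS"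
  using R T by (rule ds_inj_hom) simp_all

lemma collapse_hom: "collapse T j m \<in> mod_hom R DS (T m)"
proof (induction m)
  case 0
  show ?case by (auto simp: mod_hom_def direct_sum_closed)
next
  case (Suc m)
  interpret M: left_module R "T (Suc m)" by (rule T)
  note c = mod_hom_comp[OF Suc.IH j]
  show ?case
  proof (rule mod_homI[OF left_module_DS _ _ T])
    show "collapse T j (Suc m) v \<in> carrier (T (Suc m))" if "v \<in> carrier DS" for v
      using mod_hom_closed[OF c that] direct_sum_closed[OF that] by simp
    fix r v w assume a: "r \<in> carrier R" "v \<in> carrier DS" "w \<in> carrier DS"
    note vw = mod_hom_closed[OF c a(2)] mod_hom_closed[OF c a(3)]
      direct_sum_closed[OF a(2) UNIV_I] direct_sum_closed[OF a(3) UNIV_I]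
    show "collapse T j (Suc m) (r \<odot>\<^bsub>DS\<^esub> v \<oplus>\<^bsub>DS\<^esub> w)
        = r \<odot>\<^bsub>T (Suc m)\<^esub> collapse T j (Suc m) v \<oplus>\<^bsub>T (Suc m)\<^esub> collapse T j (Suc m) w"
      unfolding collapse.simps mod_hom_lin[OF c left_module_DS a]
      using vw a(1) by (simp add: M.smult_r_distr M.M.a_ac)
  qed
qed

lemma collapse_inj_less: "k < n \<Longrightarrow> collapse T j k (ds_inj UNIV T n y) = \<zero>\<^bsub>T k\<^esub>"
  by (induction k) (auto simp: ds_inj_def)

lemma collapse_inj_same:
  assumes "y \<in> carrier (T n)"
  shows "collapse T j n (ds_inj UNIV T n y) = y"
proof (cases n)
  case (Suc m)
  have "ds_inj UNIV T n y (Suc m) = y" by (simp add: ds_inj_def Suc)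
  then show ?thesis using assms Suc collapse_inj_less[of m n y] by simp
qed (simp add: ds_inj_def)

lemma collapse_inj_Suc:
  assumes y: "y \<in> carrier (T n)" and "n \<le> k"
  shows "collapse T j (Suc k) (ds_inj UNIV T n y) = j k (collapse T j k (ds_inj UNIV T n y))"
proof -
  have "ds_inj UNIV T n y (Suc k) = \<zero>\<^bsub>T (Suc k)\<^esub>" using assms(2) by (simp add: ds_inj_def)
  then show ?thesis
    using mod_hom_closed[OF j mod_hom_closed[OF collapse_hom mod_hom_closed[OF inj_hom y]], of k]
    by simp
qed

lemma submodule_eventually_collapse:
  "submodule {v \<in> carrier DS. \<exists>m. \<forall>k\<ge>m. collapse T j k v = \<zero>\<^bsub>T k\<^esub>} R DS"
proof (rule DS.submoduleI)
  let ?N = "{v \<in> carrier DS. \<exists>m. \<forall>k\<ge>m. collapse T j k v = \<zero>\<^bsub>T k\<^esub>}"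
  show "\<zero>\<^bsub>DS\<^esub> \<in> ?N"
    using mod_hom_zero[OF collapse_hom left_module_DS T] DS.M.zero_closed by blast
  fix v w assume vw: "v \<in> ?N" "w \<in> ?N"
  then obtain m n where "\<forall>k\<ge>m. collapse T j k v = \<zero>\<^bsub>T k\<^esub>" "\<forall>k\<ge>n. collapse T j k w = \<zero>\<^bsub>T k\<^esub>"
    by blast
  then have "\<forall>k\<ge>max m n. collapse T j k (v \<oplus>\<^bsub>DS\<^esub> w) = \<zero>\<^bsub>T k\<^esub>"
    using vw mod_hom_add[OF collapse_hom, of v w] by auto
  then show "v \<oplus>\<^bsub>DS\<^esub> w \<in> ?N" using vw DS.M.a_closed by blast
next
  let ?N = "{v \<in> carrier DS. \<exists>m. \<forall>k\<ge>m. collapse T j k v = \<zero>\<^bsub>T k\<^esub>}"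
  fix r v assume r: "r \<in> carrier R" and v: "v \<in> ?N"
  then obtain m where "\<forall>k\<ge>m. collapse T j k v = \<zero>\<^bsub>T k\<^esub>" by blast
  then have "\<forall>k\<ge>m. collapse T j k (r \<odot>\<^bsub>DS\<^esub> v) = \<zero>\<^bsub>T k\<^esub>"
    using r v mod_hom_smult[OF collapse_hom, of r v] left_module.smult_zero_right[OF T] by auto
  then show "r \<odot>\<^bsub>DS\<^esub> v \<in> ?N" using r v DS.smult_closed by blast
qed auto

abbreviation (input) "rel_generators \<equiv>
  \<Union>n. (\<lambda>y. ds_inj UNIV T n y \<ominus>\<^bsub>DS\<^esub> ds_inj UNIV T (Suc n) (j n y)) ` carrier (T n)"

lemma rel_generator_collapse:
  assumes "v \<in> rel_generators"
  shows "v \<in> carrier DS" "\<exists>m. \<forall>k\<ge>m. collapse T j k v = \<zero>\<^bsub>T k\<^esub>"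
proof -
  obtain n y where y: "y \<in> carrier (T n)"
    and v: "v = ds_inj UNIV T n y \<ominus>\<^bsub>DS\<^esub> ds_inj UNIV T (Suc n) (j n y)"
    using assms by blast
  let ?a = "ds_inj UNIV T n y" and ?b = "ds_inj UNIV T (Suc n) (j n y)"
  have jy: "j n y \<in> carrier (T (Suc n))" using y by (rule mod_hom_closed[OF j])
  have ab: "?a \<in> carrier DS" "?b \<in> carrier DS"
    using mod_hom_closed[OF inj_hom y] mod_hom_closed[OF inj_hom jy] .
  show "v \<in> carrier DS" unfolding v using ab by simp
  have same: "collapse T j k ?a = collapse T j k ?b" if "Suc n \<le> k" for k
    using that
  proof (induction k rule: dec_induct)
    case base
    show ?case using collapse_inj_Suc[OF y order_refl] collapse_inj_same[OF y] collapse_inj_same[OF jy]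
      by simp
  next
    case (step k)
    then show ?case using collapse_inj_Suc[OF y, of k] collapse_inj_Suc[OF jy, of k] by simp
  qed
  have "collapse T j k v = \<zero>\<^bsub>T k\<^esub>" if "Suc n \<le> k" for k
  proof -
    interpret M: left_module R "T k" by (rule T)
    show ?thesis
      unfolding v DS.M.minus_eq mod_hom_add[OF collapse_hom ab(1) DS.M.a_inv_closed[OF ab(2)]]
        mod_hom_minus[OF collapse_hom left_module_DS T ab(2)] same[OF that]
      using mod_hom_closed[OF collapse_hom ab(2)] by (rule M.M.r_neg)
  qed
  then show "\<exists>m. \<forall>k\<ge>m. collapse T j k v = \<zero>\<^bsub>T k\<^esub>" by blast
qed

lemma dirlim_relations_collapse:
  assumes "v \<in> dirlim_relations R T j"
  shows "\<exists>m. \<forall>k\<ge>m. collapse T j k v = \<zero>\<^bsub>T k\<^esub>"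
proof -
  have "dirlim_relations R T j \<subseteq> {v \<in> carrier DS. \<exists>m. \<forall>k\<ge>m. collapse T j k v = \<zero>\<^bsub>T k\<^esub>}"
    unfolding dirlim_relations_def
  proof (rule hull_minimal[where S = "\<lambda>N. submodule N R DS", OF _ submodule_eventually_collapse], rule subsetI)
    fix v assume "v \<in> rel_generators"
    from rel_generator_collapse[OF this]
    show "v \<in> {v \<in> carrier DS. \<exists>m. \<forall>k\<ge>m. collapse T j k v = \<zero>\<^bsub>T k\<^esub>}" by simp
  qed
  then show ?thesis using assms by blast
qed

lemma submodule_dirlim_relations: "submodule (dirlim_relations R T j) R DS"
proof -
  let ?H = "{N. submodule N R DS \<and> rel_generators \<subseteq> N}"
  have N: "dirlim_relations R T j = \<Inter>?H"
    by (simp add: dirlim_relations_def hull_def)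
  have "submodule (carrier DS) R DS"
    by (rule DS.submoduleI) (auto simp del: direct_sum_simps)
  then have "carrier DS \<in> ?H" using rel_generator_collapse(1) by auto
  then have sub: "\<Inter>?H \<subseteq> carrier DS" by (rule Inter_lower)
  have H: "\<zero>\<^bsub>DS\<^esub> \<in> N" "a \<in> N \<Longrightarrow> b \<in> N \<Longrightarrow> a \<oplus>\<^bsub>DS\<^esub> b \<in> N"
    "r \<in> carrier R \<Longrightarrow> a \<in> N \<Longrightarrow> r \<odot>\<^bsub>DS\<^esub> a \<in> N" if "N \<in> ?H" for N a b r
  proof -
    interpret submodule N R DS using that by simp
    show "\<zero>\<^bsub>DS\<^esub> \<in> N" "a \<in> N \<Longrightarrow> b \<in> N \<Longrightarrow> a \<oplus>\<^bsub>DS\<^esub> b \<in> N"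
      "r \<in> carrier R \<Longrightarrow> a \<in> N \<Longrightarrow> r \<odot>\<^bsub>DS\<^esub> a \<in> N"
      using one_closed m_closed smult_closed by (simp_all del: direct_sum_simps)
  qed
  show ?thesis
    unfolding N using sub
  proof (rule DS.submoduleI)
    show "\<zero>\<^bsub>DS\<^esub> \<in> \<Inter>?H" using H(1) by (rule InterI)
    show "a \<oplus>\<^bsub>DS\<^esub> b \<in> \<Inter>?H" if "a \<in> \<Inter>?H" "b \<in> \<Inter>?H" for a b
      using that by (intro InterI H(2)) (auto simp del: direct_sum_simps)
    show "r \<odot>\<^bsub>DS\<^esub> a \<in> \<Inter>?H" if "r \<in> carrier R" "a \<in> \<Inter>?H" for r a
      using that by (intro InterI H(3)) (auto simp del: direct_sum_simps)
  qed
qed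

lemma left_module_dirlim: "left_module R (dirlim R T j)"
  unfolding dirlim_def using left_module_DS submodule_dirlim_relations by (rule left_module_quot)

abbreviation (input) "cls v \<equiv> dirlim_relations R T j +>\<^bsub>DS\<^esub> v"

lemma cls_hom: "(\<lambda>v. cls v) \<in> mod_hom R DS (dirlim R T j)"
  unfolding dirlim_def using left_module_DS submodule_dirlim_relations by (rule quot_map_hom)

lemma dirlim_map_hom: "dirlim_map R T j n \<in> mod_hom R (T n) (dirlim R T j)"
  using mod_hom_comp[OF inj_hom cls_hom] by (simp add: dirlim_map_def[abs_def])

lemma dirlim_map_Suc:
  assumes y: "y \<in> carrier (T n)"
  shows "dirlim_map R T j (Suc n) (j n y) = dirlim_map R T j n y"
proof -
  have jy: "j n y \<in> carrier (T (Suc n))" using y by (rule mod_hom_closed[OF j])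
  have "ds_inj UNIV T n y \<ominus>\<^bsub>DS\<^esub> ds_inj UNIV T (Suc n) (j n y) \<in> dirlim_relations R T j"
    unfolding dirlim_relations_def using y by (intro hull_inc) blast
  then show ?thesis
    unfolding dirlim_map_def
    using quot_map_eq_iff[OF left_module_DS submodule_dirlim_relations
        mod_hom_closed[OF inj_hom y] mod_hom_closed[OF inj_hom jy]] by simp
qed

lemma dirlim_map_inj: "inj_on (dirlim_map R T j n) (carrier (T n))"
proof (rule inj_onI)
  interpret M: left_module R "T n" by (rule T)
  fix x y assume xy: "x \<in> carrier (T n)" "y \<in> carrier (T n)"
    and eq: "dirlim_map R T j n x = dirlim_map R T j n y"
  let ?a = "ds_inj UNIV T n x" and ?b = "ds_inj UNIV T n y"
  have ab: "?a \<in> carrier DS" "?b \<in> carrier DS" using mod_hom_closed[OF inj_hom] xy by auto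
  have "?a \<ominus>\<^bsub>DS\<^esub> ?b \<in> dirlim_relations R T j"
    using eq quot_map_eq_iff[OF left_module_DS submodule_dirlim_relations ab]
    by (simp add: dirlim_map_def)
  then obtain m where m: "\<forall>k\<ge>m. collapse T j k (?a \<ominus>\<^bsub>DS\<^esub> ?b) = \<zero>\<^bsub>T k\<^esub>"
    using dirlim_relations_collapse by blast
  have sub: "collapse T j k (?a \<ominus>\<^bsub>DS\<^esub> ?b) = collapse T j k ?a \<ominus>\<^bsub>T k\<^esub> collapse T j k ?b" for k
    unfolding a_minus_def mod_hom_add[OF collapse_hom ab(1) DS.M.a_inv_closed[OF ab(2)]]
      mod_hom_minus[OF collapse_hom left_module_DS T ab(2)] ..
  have "collapse T j k ?a = collapse T j k ?b" if "k \<ge> m" for k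
    using m that sub[of k] mod_hom_closed[OF collapse_hom ab(1)] mod_hom_closed[OF collapse_hom ab(2)]
      left_module.diff_eq_zero_iff[OF T] by metis
  moreover have "x = y" if "n \<le> k" "collapse T j k ?a = collapse T j k ?b" for k
    using that
  proof (induction k rule: dec_induct)
    case base
    then show ?case using xy by (simp add: collapse_inj_same)
  next
    case (step k)
    then show ?case
      using inj_onD[OF j_inj[of k]] collapse_inj_Suc[OF xy(1)] collapse_inj_Suc[OF xy(2)]
        mod_hom_closed[OF collapse_hom ab(1)] mod_hom_closed[OF collapse_hom ab(2)] by metis
  qed
  ultimately show "x = y" by (meson max.cobounded1 max.cobounded2)
qed

lemma dirlim_map_mono:
  assumes "m \<le> n"
  shows "dirlim_map R T j m ` carrier (T m) \<subseteq> dirlim_map R T j n ` carrier (T n)"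
proof (rule lift_Suc_mono_le[of "\<lambda>n. dirlim_map R T j n ` carrier (T n)", OF _ assms])
  fix n
  show "dirlim_map R T j n ` carrier (T n) \<subseteq> dirlim_map R T j (Suc n) ` carrier (T (Suc n))"
  proof (rule image_subsetI)
    fix y assume y: "y \<in> carrier (T n)"
    have "dirlim_map R T j (Suc n) (j n y) \<in> dirlim_map R T j (Suc n) ` carrier (T (Suc n))"
      by (rule imageI) (rule mod_hom_closed[OF j y])
    then show "dirlim_map R T j n y \<in> dirlim_map R T j (Suc n) ` carrier (T (Suc n))"
      by (simp only: dirlim_map_Suc[OF y])
  qed
qed

lemma dirlim_map_image_lin:
  assumes "r \<in> carrier R" "a \<in> dirlim_map R T j m ` carrier (T m)" "b \<in> dirlim_map R T j m ` carrier (T m)"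
  shows "r \<odot>\<^bsub>dirlim R T j\<^esub> a \<oplus>\<^bsub>dirlim R T j\<^esub> b \<in> dirlim_map R T j m ` carrier (T m)"
proof -
  obtain x y where "x \<in> carrier (T m)" "y \<in> carrier (T m)"
    "a = dirlim_map R T j m x" "b = dirlim_map R T j m y"
    using assms(2,3) by blast
  then show ?thesis
    using assms(1) left_module.smult_closed[OF T]
    by (auto simp: mod_hom_lin[OF dirlim_map_hom T, symmetric] intro!: imageI)
qed

lemma dirlim_surj:
  assumes "a \<in> carrier (dirlim R T j)"
  shows "\<exists>m. a \<in> dirlim_map R T j m ` carrier (T m)"
proof -
  have "\<forall>v\<in>carrier DS. (\<forall>i>m. v i = \<zero>\<^bsub>T i\<^esub>) \<longrightarrow> cls v \<in> dirlim_map R T j m ` carrier (T m)" for m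
  proof (induction m)
    case 0
    have "v = ds_inj UNIV T 0 (v 0)" if "\<forall>i>0. v i = \<zero>\<^bsub>T i\<^esub>" for v
      using that by (auto simp: ds_inj_def)
    then show ?case
      using direct_sum_closed[OF _ UNIV_I, of _ T 0] unfolding dirlim_map_def by (metis imageI)
  next
    case (Suc m)
    show ?case
    proof (intro ballI impI)
      fix v assume v: "v \<in> carrier DS" and v0: "\<forall>i>Suc m. v i = \<zero>\<^bsub>T i\<^esub>"
      let ?n = "Suc m"
      define w where "w = v(?n := \<zero>\<^bsub>T ?n\<^esub>)"
      note vn = direct_sum_closed[OF v UNIV_I, of ?n]
      have w0: "w i = \<zero>\<^bsub>T i\<^esub>" if "i > m" for i
        using v0 that by (cases "i = ?n") (auto simp: w_def)
      have w: "w \<in> carrier DS"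
        by (rule direct_sumI[where F = "{..m}"])
          (use w0 direct_sum_closed[OF v] in \<open>auto simp: w_def\<close>)
      have "\<one>\<^bsub>R\<^esub> \<odot>\<^bsub>DS\<^esub> w \<oplus>\<^bsub>DS\<^esub> ds_inj UNIV T ?n (v ?n) = v"
        unfolding DS.smult_one[OF w]
        using direct_sum_closed[OF v] by (auto simp: w_def ds_inj_def)
      then have "cls v = \<one>\<^bsub>R\<^esub> \<odot>\<^bsub>dirlim R T j\<^esub> cls w \<oplus>\<^bsub>dirlim R T j\<^esub> dirlim_map R T j ?n (v ?n)"
        using mod_hom_lin[OF cls_hom left_module_DS DS.R.one_closed w mod_hom_closed[OF inj_hom vn]]
        by (simp only: dirlim_map_def)
      moreover have "cls w \<in> dirlim_map R T j ?n ` carrier (T ?n)"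
      proof (rule subsetD[OF dirlim_map_mono[of m ?n]])
        show "cls w \<in> dirlim_map R T j m ` carrier (T m)"
          by (rule Suc.IH[rule_format]) (use w w0 in auto)
      qed simp
      ultimately show "cls v \<in> dirlim_map R T j ?n ` carrier (T ?n)"
        using vn by (simp only:) (blast intro: dirlim_map_image_lin DS.R.one_closed)
    qed
  qed
  moreover obtain v where v: "v \<in> carrier DS" "a = cls v"
    using assms quot_map_surj[OF left_module_DS submodule_dirlim_relations] unfolding dirlim_def by blast
  moreover obtain m where "\<forall>i>m. v i = \<zero>\<^bsub>T i\<^esub>"
    using direct_sum_finite[OF v(1)] finite_nat_set_iff_bounded_le by (metis (mono_tags, lifting) UNIV_I leD mem_Collect_eq)
  ultimately show ?thesis by blast
qed

lemma dirlim_hom_free: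
  fixes n :: nat
  defines "L \<equiv> direct_sum {..<n} (\<lambda>_. self_module R)"
  assumes h: "h \<in> mod_hom R L (dirlim R T j)"
  shows "\<exists>m. h ` carrier L \<subseteq> dirlim_map R T j m ` carrier (T m)"
proof -
  interpret R: ring R by (rule R)
  have L: "left_module R L"
    unfolding L_def using R ring.left_module_self[OF R] by (rule left_module_direct_sum)
  interpret L: left_module R L by (rule L)
  have L_zero: "\<zero>\<^bsub>L\<^esub> = (\<lambda>i\<in>{..<n}. \<zero>\<^bsub>R\<^esub>)" by (simp add: L_def)
  have "\<exists>m. \<forall>v\<in>carrier L. (\<forall>i<n. k \<le> i \<longrightarrow> v i = \<zero>\<^bsub>R\<^esub>) \<longrightarrow> h v \<in> dirlim_map R T j m ` carrier (T m)"
    if "k \<le> n" for k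
    using that
  proof (induction k)
    case 0
    have "h v = \<zero>\<^bsub>dirlim R T j\<^esub>" if "v \<in> carrier L" "\<forall>i<n. 0 \<le> i \<longrightarrow> v i = \<zero>\<^bsub>R\<^esub>" for v
    proof -
      have "v = \<zero>\<^bsub>L\<^esub>"
        unfolding L_zero using that direct_sum_extensional[of v "{..<n}"]
        by (intro extensionalityI[of _ "{..<n}"]) (auto simp: L_def)
      then show ?thesis using mod_hom_zero[OF h L left_module_dirlim] by simp
    qed
    then show ?case
      using mod_hom_zero[OF dirlim_map_hom T left_module_dirlim] T_zero by (metis imageI)
  next
    case (Suc k)
    then obtain m where m: "\<And>v. v \<in> carrier L \<Longrightarrow> \<forall>i<n. k \<le> i \<longrightarrow> v i = \<zero>\<^bsub>R\<^esub> \<Longrightarrow>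
        h v \<in> dirlim_map R T j m ` carrier (T m)"
      by (metis Suc_leD)
    define e where "e = (\<lambda>i\<in>{..<n}. if i = k then \<one>\<^bsub>R\<^esub> else \<zero>\<^bsub>R\<^esub>)"
    have e: "e \<in> carrier L"
      unfolding L_def e_def by (rule direct_sumI[where F = "{k}"]) auto
    obtain m' where m': "h e \<in> dirlim_map R T j m' ` carrier (T m')"
      using dirlim_surj[OF mod_hom_closed[OF h e]] by blast
    let ?I = "dirlim_map R T j (max m m') ` carrier (T (max m m'))"
    have "h v \<in> ?I" if v: "v \<in> carrier L" "\<forall>i<n. Suc k \<le> i \<longrightarrow> v i = \<zero>\<^bsub>R\<^esub>" for v
    proof -
      have vc: "v i \<in> carrier R" if "i < n" for i
        using direct_sum_closed[of v "{..<n}" "\<lambda>_. self_module R" i] v(1) that by (simp add: L_def)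
      have v_ext: "v \<in> extensional {..<n}" using v(1) unfolding L_def by (rule direct_sum_extensional)
      define w where "w = v(k := \<zero>\<^bsub>R\<^esub>)"
      have w: "w \<in> carrier L"
        unfolding L_def w_def
        by (rule direct_sumI[where F = "{..<n}"])
          (use vc v_ext Suc.prems in \<open>auto simp: extensional_def\<close>)
      have "\<forall>i<n. k \<le> i \<longrightarrow> w i = \<zero>\<^bsub>R\<^esub>" using v(2) by (auto simp: w_def)
      then have hw: "h w \<in> ?I" using m[OF w] dirlim_map_mono[of m "max m m'"] by auto
      have he: "h e \<in> ?I" using m' dirlim_map_mono[of m' "max m m'"] by auto
      have k: "k < n" using Suc.prems by simp
      have "v = v k \<odot>\<^bsub>L\<^esub> e \<oplus>\<^bsub>L\<^esub> w"
        by (rule extensionalityI[OF v_ext]) (use vc k in \<open>auto simp: L_def e_def w_def\<close>)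
      then have "h v = v k \<odot>\<^bsub>dirlim R T j\<^esub> h e \<oplus>\<^bsub>dirlim R T j\<^esub> h w"
        using mod_hom_lin[OF h L vc[OF k] e w] by simp
      then show ?thesis using dirlim_map_image_lin[OF vc[OF k] he hw] by simp
    qed
    then show ?case by blast
  qed
  from this[of n] show ?thesis by auto
qed

lemma dirlim_hom_factors:
  assumes X: "left_module R X" and fp: "finitely_presented R X" and f: "f \<in> mod_hom R X (dirlim R T j)"
  shows "\<exists>m. \<exists>f'\<in>mod_hom R X (T m). \<forall>x\<in>carrier X. f x = dirlim_map R T j m (f' x)"
proof -
  interpret X: left_module R X by (fact X)
  obtain n :: nat and p where p: "p \<in> mod_hom R (direct_sum {..<n} (\<lambda>_. self_module R)) X"
    "p ` carrier (direct_sum {..<n} (\<lambda>_. self_module R)) = carrier X"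
    using fp unfolding finitely_presented_def by blast
  obtain m where m: "(\<lambda>v. f (p v)) ` carrier (direct_sum {..<n} (\<lambda>_. self_module R))
      \<subseteq> dirlim_map R T j m ` carrier (T m)"
    using dirlim_hom_free[OF mod_hom_comp[OF p(1) f]] by blast
  have "f ` carrier X \<subseteq> dirlim_map R T j m ` carrier (T m)"
    using m unfolding p(2)[symmetric] by auto
  then have "\<forall>x\<in>carrier X. \<exists>y. y \<in> carrier (T m) \<and> f x = dirlim_map R T j m y" by blast
  then obtain f' where f': "\<And>x. x \<in> carrier X \<Longrightarrow> f' x \<in> carrier (T m)"
    "\<And>x. x \<in> carrier X \<Longrightarrow> f x = dirlim_map R T j m (f' x)"
    by metis
  interpret M: left_module R "T m" by (rule T)
  have "f' \<in> mod_hom R X (T m)"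
  proof (rule mod_homI[OF X f'(1) _ T])
    fix r x y assume a: "r \<in> carrier R" "x \<in> carrier X" "y \<in> carrier X"
    have "dirlim_map R T j m (f' (r \<odot>\<^bsub>X\<^esub> x \<oplus>\<^bsub>X\<^esub> y)) = f (r \<odot>\<^bsub>X\<^esub> x \<oplus>\<^bsub>X\<^esub> y)"
      using a by (intro f'(2)[symmetric]) simp
    also have "\<dots> = r \<odot>\<^bsub>dirlim R T j\<^esub> f x \<oplus>\<^bsub>dirlim R T j\<^esub> f y"
      by (rule mod_hom_lin[OF f X a])
    also have "\<dots> = dirlim_map R T j m (r \<odot>\<^bsub>T m\<^esub> f' x \<oplus>\<^bsub>T m\<^esub> f' y)"
      unfolding f'(2)[OF a(2)] f'(2)[OF a(3)]
      by (rule mod_hom_lin[OF dirlim_map_hom T a(1) f'(1)[OF a(2)] f'(1)[OF a(3)], symmetric])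
    finally show "f' (r \<odot>\<^bsub>X\<^esub> x \<oplus>\<^bsub>X\<^esub> y) = r \<odot>\<^bsub>T m\<^esub> f' x \<oplus>\<^bsub>T m\<^esub> f' y"
      by (rule inj_onD[OF dirlim_map_inj]) (use a f'(1) in auto)
  qed
  then show ?thesis using f'(2) by blast
qed

end

theorem proposition4p5:
  fixes R :: "('r, 'q) ring_scheme"
    and \<X> :: "('r, 'x) module set"
    and Y :: "('r, 'm) module"
    and T :: "nat \<Rightarrow> ('r, 'm) module"
    and j :: "nat \<Rightarrow> 'm \<Rightarrow> 'm"
    and X :: "('r, 'x) module"
    and f :: "'x \<Rightarrow> (nat \<Rightarrow> 'm) set"
  assumes "ring R"
    and "semibrick R \<X>"
    and "left_module R Y"
    and "universal_tower R \<X> Y T j"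
    and "X \<in> \<X>"
    and "f \<in> mod_hom R X (dirlim R T j)"
  shows "f ` carrier X \<subseteq> dirlim_map R T j 0 ` carrier Y"
proof -
  have T0: "T 0 = Y" and um: "universal_mono R \<X> (T n) (T (Suc n)) (j n)" for n
    using assms(4) by (auto simp: universal_tower_def)
  have um': "left_module R (T (Suc n)) \<and> j n \<in> mod_hom R (T n) (T (Suc n)) \<and> inj_on (j n) (carrier (T n))" for n
    using um[of n] by (auto simp: universal_mono_def short_exact_def)
  have T: "left_module R (T n)" for n
  proof (cases n)
    case 0
    then show ?thesis using assms(3) T0 by simp
  next
    case (Suc m)
    then show ?thesis using um'[of m] by simp
  qed
  have j: "j n \<in> mod_hom R (T n) (T (Suc n))" and j_inj: "inj_on (j n) (carrier (T n))" for n
    using um'[of n] by blast+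
  have X: "left_module R X" "finitely_presented R X"
    using assms(2,5) by (auto simp: semibrick_def brick_def)
  have descend: "dirlim_map R T j m ` h ` carrier X \<subseteq> dirlim_map R T j 0 ` carrier Y"
    if "h \<in> mod_hom R X (T m)" for h m
    using that
  proof (induction m arbitrary: h)
    case 0
    then show ?case using mod_hom_closed[OF 0] by (auto simp: T0)
  next
    case (Suc m)
    have "h ` carrier X \<subseteq> j m ` carrier (T m)"
      by (rule universal_mono_hom_image[OF assms(1,2) T um assms(5) Suc.prems])
    then have "\<forall>x\<in>carrier X. \<exists>y. y \<in> carrier (T m) \<and> h x = j m y" by blast
    then obtain k where k: "\<And>x. x \<in> carrier X \<Longrightarrow> k x \<in> carrier (T m)"
      "\<And>x. x \<in> carrier X \<Longrightarrow> h x = j m (k x)"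
      by metis
    interpret X: left_module R X by (fact X)
    interpret M: left_module R "T m" by (rule T)
    have "k \<in> mod_hom R X (T m)"
    proof (rule mod_homI[OF X(1) k(1) _ T])
      fix r x y assume a: "r \<in> carrier R" "x \<in> carrier X" "y \<in> carrier X"
      have "j m (k (r \<odot>\<^bsub>X\<^esub> x \<oplus>\<^bsub>X\<^esub> y)) = h (r \<odot>\<^bsub>X\<^esub> x \<oplus>\<^bsub>X\<^esub> y)"
        using a by (intro k(2)[symmetric]) simp
      also have "\<dots> = r \<odot>\<^bsub>T (Suc m)\<^esub> h x \<oplus>\<^bsub>T (Suc m)\<^esub> h y"
        by (rule mod_hom_lin[OF Suc.prems X(1) a])
      also have "\<dots> = j m (r \<odot>\<^bsub>T m\<^esub> k x \<oplus>\<^bsub>T m\<^esub> k y)"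
        unfolding k(2)[OF a(2)] k(2)[OF a(3)]
        by (rule mod_hom_lin[OF j T a(1) k(1)[OF a(2)] k(1)[OF a(3)], symmetric])
      finally show "k (r \<odot>\<^bsub>X\<^esub> x \<oplus>\<^bsub>X\<^esub> y) = r \<odot>\<^bsub>T m\<^esub> k x \<oplus>\<^bsub>T m\<^esub> k y"
        by (rule inj_onD[OF j_inj[of m]]) (use a k(1) in auto)
    qed
    then have "dirlim_map R T j m ` k ` carrier X \<subseteq> dirlim_map R T j 0 ` carrier Y" by (rule Suc.IH)
    moreover have "dirlim_map R T j (Suc m) (h x) = dirlim_map R T j m (k x)" if "x \<in> carrier X" for x
      unfolding k(2)[OF that] by (rule dirlim_map_Suc[where T = T and j = j, OF assms(1) T j j_inj k(1)[OF that]])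
    ultimately show ?case by (simp add: image_subset_iff)
  qed
  obtain m h where "h \<in> mod_hom R X (T m)" "\<forall>x\<in>carrier X. f x = dirlim_map R T j m (h x)"
    using dirlim_hom_factors[where T = T and j = j, OF assms(1) T j j_inj X assms(6)] by blast
  then show ?thesis using descend[of h m] by (simp add: image_subset_iff)
qed

end
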